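(* Let $X$ be a Euclidean space, let $m,\ell$ be positive integers, $I:=\{1,\dots,m\}$, $J:=\{1,\dots,\ell\}$, and let $\{C_i\}_{i\in I}$ be closed subsets of $X$ with $C:=\bigcap_{i\in I}C_i\neq\varnothing$. For every $j\in J$ let $\lambda_j,\mu_j\in(0,2]$, $\widehat\beta_j:=\big(\frac{\lambda_j}{2-\lambda_j}+\frac{\mu_j}{2-\mu_j}\big)^{-1}$ (with $\widehat\beta_j:=0$ if $\lambda_j=2$ or $\mu_j=2$), $\alpha_j\in(0,1+\widehat\beta_j)$, and $s_j,t_j\in I$ with $s_j\neq t_j$, such that $\{s_j\}_{j\in J}\cup\{t_j\}_{j\in J}=I$. For $j\in J$ set $T_j:=(1-\alpha_j)\mathrm{Id}+\alpha_jP_{C_{t_j}}^{\mu_j}P_{C_{s_j}}^{\lambda_j}$, $L_j:=\operatorname{aff}(C_{s_j}\cup C_{t_j})$, and let $Z_j:=(C_{s_j}\cap C_{t_j})+(L_j-L_j)^\perp$ if $\lambda_j=\mu_j=2$ and $Z_j:=C_{s_j}\cap C_{t_j}$ otherwise. Let $w\in C$, $\varepsilon\in[0,1/3]$, $\delta>0$, $\kappa>0$, and $\kappa_j>0$ for every $j\in J$. Suppose that: (a) $\{Z_j\}_{j\in J}$ is $\kappa$-linearly regular on $\mathbb{B}(w;\delta/2)$ and, for every $j\in J$, $\{C_{s_j},C_{t_j}\}$ is $\kappa_j$-linearly regular on $\mathbb{B}(w;\delta/2)$. (b) For every $i\in I$, $C_i$ is $(\varepsilon,\sqrt2\,\delta)$-regular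 at $w$. (c) For every $j\in J$, the CQ-number $\theta_j:=\theta_{C_{s_j},C_{t_j},L_j}(w,\sqrt2\,\delta)<1$. (d) Setting for every $j\in J$ $$\gamma_j:=1-\alpha_j+\alpha_j\Big(1+\tfrac{\lambda_j\varepsilon}{1-\varepsilon}\Big)\Big(1+\tfrac{\mu_j\varepsilon}{1-\varepsilon}\Big),$$ $$\nu_j:=\frac{\alpha_j\sqrt{1-\theta_j^2}}{\kappa_j}\min\Big\{\lambda_j,\frac{2\mu_j}{|1-\mu_j|+\sqrt{(1-\mu_j)^2+4\mu_j(1-\theta_j^2)}}\Big\},$$ $\nu_j':=\nu_j$ if $\lambda_j=\mu_j=2$ or $L_j=X$, and $\nu'_j:=\min\{\nu_j,\alpha_j(\lambda_j+\mu_j-\lambda_j\mu_j)\}$ otherwise, it holds that $$\rho:=\Big[\Gamma^2-\frac{\nu^2}{\kappa^2}\Big(\sum_{j\in J}\frac{\alpha_j}{1-\alpha_j+\widehat\beta_j}\Big)^{-1}\Big]_+^{\frac1{2\ell}}<1,$$ where $\Gamma:=(\gamma_1\cdots\gamma_\ell)^{1/2}$ and $\nu:=\min_{j\in J}\{\nu_j',1\}$. Let $(x_n)_{n\in\mathbb{N}}$ be a cyclic sequence generated by $(T_j)_{j\in J}$ and let $\delta_0:=\frac{\delta}{2\Gamma}\gamma_\ell^{1/2}$. If either $(x_{\ell n})_{n\in\mathbb{N}}\subset\mathbb{B}(w;\delta_0)$ or $x_0\in\mathbb{B}\big(w;\frac{\delta_0(1-\rho)}{2+\Gamma-\rho}\big)$,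 then $(x_n)_{n\in\mathbb{N}}$ converges $R$-linearly with rate $\rho$ to a point $$\overline{x}\in\bigcap_{j\in J}Z_j\subseteq\bigcap_{j\in J}\operatorname{Fix}T_j.$$ Additionally, if the cyclic algorithm defined by $(T_j)_{j\in J}$ is connected, then $P_{C_1}\overline{x}=\cdots=P_{C_m}\overline{x}\in C$.
   Context: A Euclidean space is a finite-dimensional real inner product space; $\mathbb{N}=\{0,1,2,\dots\}$; $\mathbb{B}(w;\rho)$ is the closed ball with center $w$ and radius $\rho$, and $\mathbb{B}:=\mathbb{B}(0;1)$; $[t]_+:=\max\{0,t\}$. For nonempty $S\subseteq X$: $d_S(x)=\inf_{c\in S}\|x-c\|$, and $P_Sx=\{c\in S:\|x-c\|=d_S(x)\}$ is the (set-valued) projector, identified with its element when it is a singleton (so $P_{C_1}\overline{x}=\cdots\in C$ means all these sets are the same singleton $\{p\}$ with $p\in C$). The relaxed projector is $P_S^\lambda:=(1-\lambda)\mathrm{Id}+\lambda P_S$ (set-valued). Set-valued operators are composed in the usual way: $T_jx=\{(1-\alpha_j)x+\alpha_js: s\in P_{C_{t_j}}^{\mu_j}r,\ r\in P_{C_{s_j}}^{\lambda_j}x\}$. $\operatorname{Fix}T=\{x:x\in Tx\}$. $\operatorname{aff}$ denotes affine hull. A cyclic sequence generated by $(T_j)_{j\in J}$ is any sequence with $x_0\in X$ and $x_{n+1}\in T_{n+1}x_n$ for all $n\in\mathbb{N}$, where $T_{\ell n+j}:=T_j$ for $n\in\mathbb{N}$, $j\in J$. A sequence $(x_n)$ converges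 $R$-linearly to $\overline{x}$ with rate $\rho\in[0,1)$ if there is $\sigma\ge0$ with $\|x_n-\overline{x}\|\le\sigma\rho^n$ for all $n$. The algorithm is connected if the undirected graph with vertex set $I$ and edges $\{s_j,t_j\}$, $j\in J$, is connected. A finite system $\{S_k\}_{k\in K}$ of closed sets is $\kappa$-linearly regular on $U\subseteq X$ if $d_S(x)\le\kappa\max_{k\in K}d_{S_k}(x)$ for all $x\in U$, where $S:=\bigcap_{k\in K}S_k$. Proximal normal cone to $S$ at $x\in S$: $N^{\rm prox}_S(x)=\{\lambda(z-x): z\in X,\ x\in P_Sz,\ \lambda\ge0\}$. $S$ is $(\varepsilon,\delta)$-regular at $w$ if for all $x,y\in S\cap\mathbb{B}(w;\delta)$ and $u\in N^{\rm prox}_S(x)$ one has $\langle u,x-y\rangle\ge-\varepsilon\|u\|\|x-y\|$. For nonempty $A,B\subseteq X$, an affine subspace $L\supseteq A\cup B$, $w\in X$ and $\delta>0$, the CQ-number is $\theta_{A,B,L}(w,\delta):=\sup\{\langle u,v\rangle: u\in N^{\rm prox}_A(a)\cap(L-a)\cap\mathbb{B},\ a\in A\cap\mathbb{B}(w;\delta),\ v\in-N^{\rm prox}_B(b)\cap(L-b)\cap\mathbb{B},\ b\in B\cap\mathbb{B}(w;\delta)\}$. *)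

theory Defs
  imports "HOL-Analysis.Analysis"
begin

text \<open>Distances to sets are \<^const>\<open>infdist\<close>; the sets are nonempty in every intended use
  (for an empty set \<^const>\<open>infdist\<close> is 0 and the projector below is empty).\<close>

definition projector :: "'a::euclidean_space set \<Rightarrow> 'a \<Rightarrow> 'a set" where
  "projector S x = {c \<in> S. norm (x - c) = infdist x S}"

definition relaxed_projector :: "real \<Rightarrow> 'a::euclidean_space set \<Rightarrow> 'a \<Rightarrow> 'a set" where
  "relaxed_projector lam S x = {(1 - lam) *\<^sub>R x + lam *\<^sub>R p | p. p \<in> projector S x}"

text \<open>The set-valued operator \<open>(1 - a) Id + a P\<^sub>B\<^sup>m P\<^sub>A\<^sup>l\<close>, where superscripts are relaxation
  parameters: the relaxed projection onto \<open>A\<close> is applied first.\<close>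

definition DR_operator ::
  "real \<Rightarrow> real \<Rightarrow> real \<Rightarrow> 'a::euclidean_space set \<Rightarrow> 'a set \<Rightarrow> 'a \<Rightarrow> 'a set" where
  "DR_operator a l m A B x =
     {(1 - a) *\<^sub>R x + a *\<^sub>R q | q r. r \<in> relaxed_projector l A x \<and> q \<in> relaxed_projector m B r}"

definition Fix :: "('a \<Rightarrow> 'a set) \<Rightarrow> 'a set" where
  "Fix T = {x. x \<in> T x}"

text \<open>The operators are indexed by \<open>1, \<dots>, l\<close> and extended periodically, so the operator
  number \<open>n + 1\<close> is the one with index \<open>n mod l + 1\<close>.\<close>

definition cyclic_sequence :: "nat \<Rightarrow> (nat \<Rightarrow> 'a \<Rightarrow> 'a set) \<Rightarrow> (nat \<Rightarrow> 'a) \<Rightarrow> bool" where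
  "cyclic_sequence l T x \<longleftrightarrow> (\<forall>n. x (Suc n) \<in> T (n mod l + 1) (x n))"

definition R_linearly_convergent ::
  "(nat \<Rightarrow> 'a::real_normed_vector) \<Rightarrow> 'a \<Rightarrow> real \<Rightarrow> bool" where
  "R_linearly_convergent x xbar rho \<longleftrightarrow>
     0 \<le> rho \<and> rho < 1 \<and> (\<exists>sigma\<ge>0. \<forall>n. norm (x n - xbar) \<le> sigma * rho ^ n)"

text \<open>Connectedness of the undirected graph with vertex set \<open>I\<close> and edges \<open>{s j, t j}\<close>:
  any two vertices are joined by a walk.\<close>

definition algorithm_connected ::
  "nat set \<Rightarrow> nat set \<Rightarrow> (nat \<Rightarrow> nat) \<Rightarrow> (nat \<Rightarrow> nat) \<Rightarrow> bool" where
  "algorithm_connected I J s t \<longleftrightarrow>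
     (\<forall>i\<in>I. \<forall>k\<in>I. (i, k) \<in> ({(s j, t j) | j. j \<in> J} \<union> {(t j, s j) | j. j \<in> J})\<^sup>*)"

definition linearly_regular ::
  "real \<Rightarrow> 'k set \<Rightarrow> ('k \<Rightarrow> 'a::euclidean_space set) \<Rightarrow> 'a set \<Rightarrow> bool" where
  "linearly_regular kappa K S U \<longleftrightarrow>
     (\<forall>x\<in>U. infdist x (\<Inter>k\<in>K. S k) \<le> kappa * Max ((\<lambda>k. infdist x (S k)) ` K))"

definition prox_normal_cone :: "'a::euclidean_space set \<Rightarrow> 'a \<Rightarrow> 'a set" where
  "prox_normal_cone S x = {lam *\<^sub>R (z - x) | lam z. x \<in> projector S z \<and> 0 \<le> lam}"

definition eps_delta_regular ::
  "real \<Rightarrow> real \<Rightarrow> 'a::euclidean_space set \<Rightarrow> 'a \<Rightarrow> bool" where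
  "eps_delta_regular eps del S w \<longleftrightarrow>
     (\<forall>x \<in> S \<inter> cball w del. \<forall>y \<in> S \<inter> cball w del. \<forall>u \<in> prox_normal_cone S x.
        u \<bullet> (x - y) \<ge> - eps * norm u * norm (x - y))"

text \<open>The set whose supremum is taken is bounded above by 1, and it contains 0 as soon as both
  sets meet the ball (in particular if \<open>w\<close> lies in both), so the real-valued \<^const>\<open>Sup\<close> is
  the true supremum there.\<close>

definition CQ_number ::
  "'a::euclidean_space set \<Rightarrow> 'a set \<Rightarrow> 'a set \<Rightarrow> 'a \<Rightarrow> real \<Rightarrow> real" where
  "CQ_number A B L w del =
     Sup {u \<bullet> v | u v a b.
       a \<in> A \<inter> cball w del \<and> u \<in> prox_normal_cone A a \<inter> (\<lambda>z. z - a) ` L \<inter> cball 0 1 \<and>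
       b \<in> B \<inter> cball w del \<and> v \<in> uminus ` prox_normal_cone B b \<inter> (\<lambda>z. z - b) ` L \<inter> cball 0 1}"

text \<open>The direction space \<open>L - L\<close>; for sets, \<open>L - L\<close> in HOL would be the set difference.
  In contrast, \<open>+\<close> on sets is the Minkowski sum.\<close>

definition direction_space :: "'a::euclidean_space set \<Rightarrow> 'a set" where
  "direction_space L = {x - y | x y. x \<in> L \<and> y \<in> L}"

end

theory Submission
  imports Defs
begin

text \<open>Each operator is analysed at a point of the ball by two inequalities. Regularity of the sets
  makes it a quasi-Fejer step towards every point of \<open>Z\<^sub>j\<close>, with factor \<open>\<gamma>\<^sub>j\<close> and a gain
  proportional to the squared step length; the CQ-number bounds the angle between the two projection
  displacements, so that the step length dominates \<open>\<nu>'\<^sub>j\<close> times the distance to \<open>Z\<^sub>j\<close>. The components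
  of the iterates orthogonal to \<open>L\<^sub>j\<close> do not affect the projections and are carried along separately.
  Over a full cycle, the total step length is at least \<open>\<nu>/\<kappa>\<close> times the distance to \<open>\<Inter>\<^sub>j Z\<^sub>j\<close> by linear
  regularity, and Cauchy-Schwarz turns the accumulated gain into the factor \<open>\<rho>\<^sup>l\<close> for this distance.\<close>

text \<open>On the component orthogonal to \<open>L j\<close>, one step acts as multiplication by
  \<open>1 - \<alpha> j * (lam j + \<mu> j - lam j * \<mu> j)\<close>. This is the identity exactly
  when both relaxation parameters are 2; nothing then pulls that component anywhere, and
  \<open>Z j\<close> has to contain the whole normal space. Otherwise the displacement of this
  component is part of the step length, which is how the second entry of the minimum in
  \<open>\<nu>' j\<close> arises. The obstacle is locality, since all estimates hold only near
  \<open>w\<close>. The bound \<open>\<epsilon> \<le> 1/3\<close> lets one relaxed projection at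
  most double the squared distance to \<open>w\<close>, and this yields the radius
  \<open>sqrt 2 * \<delta>\<close>. The radius \<open>\<delta>\<^sub>0\<close> absorbs the growth of
  distances under the first \<open>l - 1\<close> operators of a cycle. Within a cycle distances may
  grow; only the starts of the cycles contract. Passing from them to all indices costs a division by
  a power of \<open>\<rho>\<close>, so that \<open>\<rho> = 0\<close> needs separate care.\<close>

lemma projector_iff:
  "p \<in> projector S x \<longleftrightarrow> p \<in> S \<and> (\<forall>c\<in>S. norm (x - p) \<le> norm (x - c))"
proof
  assume "p \<in> projector S x"
  then show "p \<in> S \<and> (\<forall>c\<in>S. norm (x - p) \<le> norm (x - c))"
    unfolding projector_def using infdist_le[of _ S x] by (auto simp: dist_norm)
next
  assume *: "p \<in> S \<and> (\<forall>c\<in>S. norm (x - p) \<le> norm (x - c))"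
  then have "norm (x - p) \<le> infdist x S"
    unfolding infdist_def dist_norm using cINF_greatest[of S "norm (x - p)" "\<lambda>c. norm (x - c)"] by auto
  with * show "p \<in> projector S x"
    using infdist_le[of p S x] by (simp add: projector_def dist_norm)
qed

lemma projector_nonempty:
  assumes "closed S" "S \<noteq> {}"
  shows "projector S x \<noteq> {}"
proof -
  obtain c where "c \<in> S" "infdist x S = dist x c" using infdist_attains_inf[OF assms] by blast
  then have "c \<in> projector S x" by (simp add: projector_def dist_norm)
  then show ?thesis by blast
qed

lemma projector_self: "c \<in> S \<Longrightarrow> projector S c = {c}"
proof -
  assume "c \<in> S"
  then have "infdist c S = 0" by simp
  with \<open>c \<in> S\<close> show ?thesis by (auto simp: projector_def)
qed

lemma projector_dist_le:
  assumes "p \<in> projector S x" "w \<in> S"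
  shows "norm (p - w) \<le> 2 * norm (x - w)"
proof -
  have "norm (x - p) \<le> norm (x - w)" using assms by (simp add: projector_iff)
  moreover have "norm (p - w) \<le> norm (x - p) + norm (x - w)"
    using dist_triangle3[of p w x] by (simp add: dist_norm)
  ultimately show ?thesis by simp
qed

lemma norm_scaleR_add_power2:
  fixes u v :: "'a::real_inner"
  shows "(norm (t *\<^sub>R u + v))\<^sup>2 = t\<^sup>2 * (norm u)\<^sup>2 + (norm v)\<^sup>2 + 2 * t * (u \<bullet> v)"
  unfolding power2_norm_eq_inner by (simp only: inner_simps inner_commute[of v u] power2_eq_square) algebra

lemma orthogonal_comp_direction_space:
  "n \<in> orthogonal_comp (direction_space L) \<longleftrightarrow> (\<forall>y\<in>L. \<forall>z\<in>L. n \<bullet> (y - z) = 0)"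
proof
  assume n: "n \<in> orthogonal_comp (direction_space L)"
  have "y - z \<in> direction_space L" if "y \<in> L" "z \<in> L" for y z
    using that unfolding direction_space_def by blast
  then have "(y - z) \<bullet> n = 0" if "y \<in> L" "z \<in> L" for y z
    using n that by (simp add: orthogonal_comp_def orthogonal_def)
  then show "\<forall>y\<in>L. \<forall>z\<in>L. n \<bullet> (y - z) = 0" by (simp add: inner_commute[of n])
next
  assume "\<forall>y\<in>L. \<forall>z\<in>L. n \<bullet> (y - z) = 0"
  then have "(y - z) \<bullet> n = 0" if "y \<in> L" "z \<in> L" for y z
    using that by (simp add: inner_commute[of _ n])
  then show "n \<in> orthogonal_comp (direction_space L)"
    unfolding orthogonal_comp_def direction_space_def orthogonal_def by blast
qed

text \<open>Adding \<open>n\<close> changes the squared distances to all points of \<open>S\<close>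
  by the same amount, so the minimisers remain. This is what allows normal components to be split
  off from the iterates.\<close>

lemma projector_add_normal:
  assumes "S \<subseteq> L" "n \<in> orthogonal_comp (direction_space L)"
  shows "projector S (x + n) = projector S x"
proof -
  have "norm (x + n - p) \<le> norm (x + n - c) \<longleftrightarrow> norm (x - p) \<le> norm (x - c)"
    if "p \<in> S" "c \<in> S" for p c
  proof -
    have "n \<bullet> (p - c) = 0" using assms that by (auto simp: orthogonal_comp_direction_space)
    then have "n \<bullet> (x - p) = n \<bullet> (x - c)" by (simp add: inner_diff_right)
    moreover have "x + n - z = 1 *\<^sub>R n + (x - z)" for z by simp
    ultimately have "(norm (x + n - p))\<^sup>2 - (norm (x + n - c))\<^sup>2 = (norm (x - p))\<^sup>2 - (norm (x - c))\<^sup>2"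
      by (simp only: norm_scaleR_add_power2)
    then have "(norm (x + n - p))\<^sup>2 \<le> (norm (x + n - c))\<^sup>2 \<longleftrightarrow> (norm (x - p))\<^sup>2 \<le> (norm (x - c))\<^sup>2"
      by linarith
    then show ?thesis by simp
  qed
  then show ?thesis by (auto simp: projector_iff)
qed

lemma prox_normal_coneI: "p \<in> projector S x \<Longrightarrow> 0 \<le> t \<Longrightarrow> t *\<^sub>R (x - p) \<in> prox_normal_cone S p"
  unfolding prox_normal_cone_def by blast

lemma DR_operator_iff:
  "x' \<in> DR_operator a l m A B x \<longleftrightarrow>
     (\<exists>p q. p \<in> projector A x \<and> q \<in> projector B ((1 - l) *\<^sub>R x + l *\<^sub>R p) \<and>
        x' = (1 - a) *\<^sub>R x + a *\<^sub>R ((1 - m) *\<^sub>R ((1 - l) *\<^sub>R x + l *\<^sub>R p) + m *\<^sub>R q))"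
  unfolding DR_operator_def relaxed_projector_def by blast

section \<open>Inequalities behind a relaxed projection and its composition\<close>

lemma relaxed_step:
  fixes x p c :: "'a::euclidean_space"
  assumes k: "- eps * norm (x - p) * norm (p - c) \<le> (x - p) \<bullet> (p - c)"
    and "0 \<le> eps" "eps < 1" "0 \<le> l"
  shows "(norm ((1 - l) *\<^sub>R x + l *\<^sub>R p - c))\<^sup>2
    \<le> (1 + l * eps / (1 - eps)) * (norm (x - c))\<^sup>2 - l * (2 - l) * (norm (x - p))\<^sup>2"
proof -
  define a b k where "a = norm (x - p)" and "b = norm (p - c)" and "k = (x - p) \<bullet> (p - c)"
  have "x - c = 1 *\<^sub>R (x - p) + (p - c)" by simp
  then have D: "(norm (x - c))\<^sup>2 = a\<^sup>2 + b\<^sup>2 + 2 * k"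
    by (simp only: norm_scaleR_add_power2 a_def b_def k_def) simp
  have "(1 - l) *\<^sub>R x + l *\<^sub>R p - c = (1 - l) *\<^sub>R (x - p) + (p - c)" by (simp add: algebra_simps)
  then have R: "(norm ((1 - l) *\<^sub>R x + l *\<^sub>R p - c))\<^sup>2 = (1 - l)\<^sup>2 * a\<^sup>2 + b\<^sup>2 + 2 * (1 - l) * k"
    by (simp only: norm_scaleR_add_power2 a_def b_def k_def)
  have k': "- k \<le> eps * (a * b)" using k by (simp add: a_def b_def k_def algebra_simps)
  \<comment> \<open>The left side of the claim is exactly
    \<open>(norm (x - c))^2 - l * (2 - l) * a^2 - 2 * l * k\<close>, so only \<open>- 2 * k\<close>
    has to be bounded by a multiple of \<open>(norm (x - c))^2\<close>. The inequality between
    \<open>a * b\<close> and the squares feeds the bound on \<open>k\<close> into itself, whence the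
    denominator \<open>1 - eps\<close>.\<close>
  have "2 * (a * b) \<le> a\<^sup>2 + b\<^sup>2" using sum_squares_bound[of a b] by (simp add: mult.assoc)
  then have "2 * (a * b) * (1 - eps) \<le> a\<^sup>2 + b\<^sup>2 + 2 * k" using k' by (simp add: algebra_simps)
  then have "2 * (a * b) \<le> (a\<^sup>2 + b\<^sup>2 + 2 * k) / (1 - eps)"
    using \<open>eps < 1\<close> by (simp add: pos_le_divide_eq)
  then have "eps * (2 * (a * b)) \<le> eps * ((a\<^sup>2 + b\<^sup>2 + 2 * k) / (1 - eps))"
    using \<open>0 \<le> eps\<close> by (rule mult_left_mono)
  with k' have "- 2 * k \<le> eps * ((a\<^sup>2 + b\<^sup>2 + 2 * k) / (1 - eps))" by simp
  then have "l * (- 2 * k) \<le> l * (eps * ((a\<^sup>2 + b\<^sup>2 + 2 * k) / (1 - eps)))"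
    using \<open>0 \<le> l\<close> by (rule mult_left_mono)
  then show ?thesis unfolding D R a_def[symmetric]
    by (simp add: algebra_simps power2_eq_square add_divide_distrib)
qed

lemma norm_affine_combination:
  fixes y z :: "'a::real_inner"
  shows "(norm ((1 - a) *\<^sub>R y + a *\<^sub>R z))\<^sup>2
    = (1 - a) * (norm y)\<^sup>2 + a * (norm z)\<^sup>2 - a * (1 - a) * (norm (y - z))\<^sup>2"
  unfolding power2_norm_eq_inner
  by (simp only: inner_simps inner_commute[of z y]) algebra

text \<open>Cauchy-Schwarz after writing \<open>l * a\<close> as the product of
  \<open>sqrt (l / (2 - l))\<close> and \<open>sqrt (l * (2 - l)) * a\<close>, likewise for
  \<open>m\<close>; this is the origin of \<open>be\<close>. If a parameter equals 2, its term on
  the right vanishes and only the constant 0 remains possible.\<close>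

lemma relaxation_harmonic_bound:
  fixes l m a b :: real
  assumes "0 < l" "l \<le> 2" "0 < m" "m \<le> 2"
    and be: "be = (if l = 2 \<or> m = 2 then 0 else inverse (l / (2 - l) + m / (2 - m)))"
  shows "be * (l * a + m * b)\<^sup>2 \<le> l * (2 - l) * a\<^sup>2 + m * (2 - m) * b\<^sup>2"
proof (cases "l = 2 \<or> m = 2")
  case True
  then show ?thesis using assms by auto
next
  case False
  define P Q where "P = 2 - l" and "Q = 2 - m"
  have PQ: "P > 0" "Q > 0" using False assms by (auto simp: P_def Q_def)
  have s: "l / P + m / Q > 0" using PQ assms by (simp add: add_pos_pos)
  have "(l / P + m / Q) * (l * P * a\<^sup>2 + m * Q * b\<^sup>2) - (l * a + m * b)\<^sup>2
      = l * m / (P * Q) * (P * a - Q * b)\<^sup>2"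
    using PQ by (simp add: field_simps power2_eq_square)
  moreover have "\<dots> \<ge> 0" using PQ assms by simp
  ultimately have "(l * a + m * b)\<^sup>2 \<le> (l / P + m / Q) * (l * P * a\<^sup>2 + m * Q * b\<^sup>2)" by linarith
  then show ?thesis using False s
    by (simp add: be P_def[symmetric] Q_def[symmetric] inverse_eq_divide pos_divide_le_eq mult.commute)
qed

text \<open>The constant \<open>k\<close> is the positive root of \<open>\<tau> k\<^sup>2 + \<bar>1 - m\<bar> k = m\<close> with
  \<open>\<tau> = 1 - \<theta>\<^sup>2\<close>; it is chosen so that the quadratic form
  \<open>a\<^sup>2 + m\<^sup>2 b\<^sup>2 - 2 m \<theta> a b - \<tau> k\<^sup>2 (a\<^sup>2 + b\<^sup>2 - 2 \<theta> a b)\<close> is degenerate.\<close>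

lemma second_reflection_ratio:
  fixes m th a b c :: real
  assumes "0 < m" "0 \<le> th" "th < 1" "0 \<le> a" "0 \<le> b" "c \<le> th * (a * b)"
    and k: "k = 2 * m / (\<bar>1 - m\<bar> + sqrt ((1 - m)\<^sup>2 + 4 * m * (1 - th\<^sup>2)))"
  shows "(1 - th\<^sup>2) * k\<^sup>2 * (a\<^sup>2 + b\<^sup>2 - 2 * c) \<le> a\<^sup>2 + m\<^sup>2 * b\<^sup>2 - 2 * m * c"
proof -
  define \<tau> where "\<tau> = 1 - th\<^sup>2"
  define S where "S = sqrt ((1 - m)\<^sup>2 + 4 * m * \<tau>)"
  define e where "e = \<bar>1 - m\<bar>"
  define X where "X = \<tau> * k\<^sup>2"
  have \<tau>: "0 < \<tau>" "\<tau> \<le> 1" using assms abs_square_less_1[of th] by (auto simp: \<tau>_def)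
  have e: "e \<ge> 0" "e\<^sup>2 = (1 - m)\<^sup>2" by (auto simp: e_def)
  have "0 < (1 - m)\<^sup>2 + 4 * m * \<tau>" using \<tau> assms by (simp add: add_nonneg_pos)
  then have S: "S > 0" "S\<^sup>2 = (1 - m)\<^sup>2 + 4 * m * \<tau>" by (auto simp: S_def)
  have k_eq: "k * (e + S) = 2 * m" using e S by (simp add: k \<tau>_def[symmetric] S_def[symmetric] e_def[symmetric])
  have kpos: "k > 0" using e S assms by (simp add: k \<tau>_def[symmetric] S_def[symmetric] e_def[symmetric] add_nonneg_pos)
  \<comment> \<open>The formula for \<open>k\<close> is the usual root
    \<open>(S - e) / (2 * \<tau>)\<close> in rationalised form, because
    \<open>S^2 - e^2 = 4 * m * \<tau>\<close>.\<close>
  have root: "\<tau> * k\<^sup>2 + e * k = m"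
  proof -
    have "k * S = 2 * m - k * e" using k_eq by (simp add: algebra_simps)
    then have "k\<^sup>2 * S\<^sup>2 = (2 * m - k * e)\<^sup>2" by (metis power_mult_distrib)
    then have "k\<^sup>2 * (e\<^sup>2 + 4 * m * \<tau>) = (2 * m - k * e)\<^sup>2" by (simp only: S(2) e(2))
    then have "4 * m * (\<tau> * k\<^sup>2 + e * k - m) = 0" by (simp add: algebra_simps power2_eq_square)
    then show ?thesis using \<open>0 < m\<close> by simp
  qed
  have X_eq: "X = m - e * k" using root by (simp add: X_def)
  have X_le_m: "X \<le> m" using X_eq e kpos by simp
  \<comment> \<open>These are the diagonal coefficients of the form being nonnegative. The left side
    of \<open>root\<close> increases in \<open>k\<close>, so a lower bound for \<open>k\<close>
    follows by testing a value \<open>y\<close>: 1 if \<open>m > 1\<close>, and \<open>m\<close> if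
    \<open>m \<le> 1\<close>.\<close>
  have X1: "X \<le> 1" and Xm: "X \<le> m\<^sup>2"
  proof -
    have mono: "\<tau> * y\<^sup>2 + e * y \<le> m \<Longrightarrow> 0 < y \<Longrightarrow> y \<le> k" for y
    proof (rule ccontr)
      assume y: "\<tau> * y\<^sup>2 + e * y \<le> m" "0 < y" "\<not> y \<le> k"
      then have "k\<^sup>2 < y\<^sup>2" using kpos by (simp add: power_strict_mono)
      then have "\<tau> * k\<^sup>2 < \<tau> * y\<^sup>2" using \<tau> by simp
      moreover have "e * k \<le> e * y" using y e by (simp add: mult_left_mono)
      ultimately show False using y root by simp
    qed
    show "X \<le> 1"
    proof (cases "m \<le> 1")
      case False
      have "1 \<le> k" using mono[of 1] \<tau> False by (simp add: e_def)
      then have "m - 1 \<le> (m - 1) * k" using False by simp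
      moreover have "X = m - (m - 1) * k" using False by (simp add: X_eq e_def)
      ultimately show ?thesis by linarith
    qed (use X_le_m in simp)
    show "X \<le> m\<^sup>2"
    proof (cases "m \<le> 1")
      case True
      have "\<tau> * m\<^sup>2 + e * m = m - (1 - \<tau>) * m\<^sup>2"
        using True by (simp add: e_def algebra_simps power2_eq_square)
      then have "m \<le> k" using mono[of m] \<tau> assms by simp
      then have "(1 - m) * m \<le> (1 - m) * k" using True by (intro mult_left_mono) auto
      moreover have "X = m - (1 - m) * k" using True by (simp add: X_eq e_def)
      moreover have "(1 - m) * m = m - m\<^sup>2" by (simp add: algebra_simps power2_eq_square)
      ultimately show ?thesis by linarith
    next
      case False
      then have "1 \<le> m\<^sup>2" by simp
      with \<open>X \<le> 1\<close> show ?thesis by simp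
    qed
  qed
  \<comment> \<open>Vanishing discriminant:
    \<open>(1 - X) * (m^2 - X) = (m - X)^2 - (1 - m)^2 * X\<close>, and by the choice of
    \<open>k\<close> the subtracted term is \<open>\<tau> * (m - X)^2\<close>. Hence the form is the
    perfect square of \<open>P * a - Q * b\<close> below.\<close>
  have disc: "(th * (m - X))\<^sup>2 = (1 - X) * (m\<^sup>2 - X)"
  proof -
    have th2: "th\<^sup>2 = 1 - \<tau>" by (simp add: \<tau>_def)
    have "(m - X)\<^sup>2 = (1 - m)\<^sup>2 * k\<^sup>2" using X_eq e by (simp add: power_mult_distrib)
    then have "\<tau> * (m - X)\<^sup>2 = (1 - m)\<^sup>2 * X" by (simp add: X_def)
    then show ?thesis unfolding power_mult_distrib th2 by (simp add: algebra_simps power2_eq_square)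
  qed
  have "0 \<le> (1 - X) * a\<^sup>2 + (m\<^sup>2 - X) * b\<^sup>2 - 2 * (th * (m - X)) * (a * b)"
  proof -
    define P Q where "P = sqrt (1 - X)" and "Q = sqrt (m\<^sup>2 - X)"
    have PQ2: "P\<^sup>2 = 1 - X" "Q\<^sup>2 = m\<^sup>2 - X" using X1 Xm by (auto simp: P_def Q_def)
    have "th * (m - X) = sqrt ((th * (m - X))\<^sup>2)" using X_le_m assms by simp
    then have PQ: "th * (m - X) = P * Q" unfolding disc by (simp add: P_def Q_def real_sqrt_mult)
    have "(P * a - Q * b)\<^sup>2 = P\<^sup>2 * a\<^sup>2 + Q\<^sup>2 * b\<^sup>2 - 2 * (P * Q) * (a * b)" by algebra
    then have "(P * a - Q * b)\<^sup>2 = (1 - X) * a\<^sup>2 + (m\<^sup>2 - X) * b\<^sup>2 - 2 * (th * (m - X)) * (a * b)"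
      by (simp only: PQ2 PQ)
    then show ?thesis by (metis zero_le_power2)
  qed
  \<comment> \<open>The difference of the two sides of the claim decreases in \<open>c\<close>, as
    \<open>X \<le> m\<close>; the worst case is therefore \<open>c = th * (a * b)\<close>.\<close>
  moreover have "(m - X) * c \<le> (m - X) * (th * (a * b))" using X_le_m assms by (intro mult_left_mono) auto
  ultimately show ?thesis unfolding \<tau>_def[symmetric] X_def[symmetric] by (simp add: algebra_simps)
qed

section \<open>Projection onto an affine subspace\<close>

lemma closest_point_affine_normal:
  fixes L :: "'a::euclidean_space set"
  assumes "affine L" "L \<noteq> {}"
  shows "x - closest_point L x \<in> orthogonal_comp (direction_space L)"
proof -
  have L: "convex L" "closed L" using assms by (auto simp: affine_imp_convex affine_closed)
  define c where "c = closest_point L x"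
  have c: "c \<in> L" using L assms by (simp add: c_def closest_point_in_set)
  have 0: "(x - c) \<bullet> (y - c) = 0" if "y \<in> L" for y
  proof -
    \<comment> \<open>The reflection of \<open>y\<close> through \<open>c\<close> stays in
      \<open>L\<close>; the variational inequality at \<open>y\<close> and at its reflection gives
      both signs.\<close>
    have "2 *\<^sub>R c - y \<in> L"
      using mem_affine[OF assms(1) c that, of 2 "-1"] by simp
    from closest_point_dot[OF L this, of x] closest_point_dot[OF L that, of x]
    show ?thesis unfolding c_def[symmetric] by (simp add: inner_diff_right scaleR_2 inner_add_right)
  qed
  have "(x - c) \<bullet> (y - z) = 0" if "y \<in> L" "z \<in> L" for y z
    using 0[OF that(1)] 0[OF that(2)] by (simp add: inner_diff_right)
  then show ?thesis by (simp add: c_def[symmetric] orthogonal_comp_direction_space)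
qed

lemma closest_point_affine_unique:
  fixes L :: "'a::euclidean_space set"
  assumes "affine L" "c \<in> L" "n \<in> orthogonal_comp (direction_space L)"
  shows "closest_point L (c + n) = c"
proof -
  have L: "convex L" "closed L" using assms by (auto simp: affine_imp_convex affine_closed)
  have "c \<in> projector L (c + n)"
    using assms by (simp add: projector_add_normal[OF order_refl assms(3)] projector_self)
  then have "\<forall>z\<in>L. dist (c + n) c \<le> dist (c + n) z" by (simp add: projector_iff dist_norm)
  from closest_point_unique[OF L assms(2) this] show ?thesis by simp
qed

subsection \<open>A single relaxed Douglas-Rachford step\<close>

locale DR_pair =
  fixes A B L Z :: "'a::euclidean_space set" and w :: 'a
    and eps del lam mu be al kap th gam nu nu' :: real
  assumes closedA: "closed A" and closedB: "closed B" and wA: "w \<in> A" and wB: "w \<in> B"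
    and eps: "0 \<le> eps" "eps \<le> 1/3" and del: "0 < del"
    and lam: "0 < lam" "lam \<le> 2" and mu: "0 < mu" "mu \<le> 2"
    and be: "be = (if lam = 2 \<or> mu = 2 then 0 else inverse (lam / (2 - lam) + mu / (2 - mu)))"
    and al: "0 < al" "al < 1 + be"
    and L: "L = affine hull (A \<union> B)"
    and Z: "Z = (if lam = 2 \<and> mu = 2 then (A \<inter> B) + orthogonal_comp (direction_space L)
                 else A \<inter> B)"
    and kap: "0 < kap"
    and lin: "\<And>x. x \<in> cball w (del / 2) \<Longrightarrow> infdist x (A \<inter> B) \<le> kap * max (infdist x A) (infdist x B)"
    and regA: "eps_delta_regular eps (sqrt 2 * del) A w"
    and regB: "eps_delta_regular eps (sqrt 2 * del) B w"
    and th: "th = CQ_number A B L w (sqrt 2 * del)" and th_less: "th < 1"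
    and gam: "gam = 1 - al + al * (1 + lam * eps / (1 - eps)) * (1 + mu * eps / (1 - eps))"
    and nu: "nu = al * sqrt (1 - th\<^sup>2) / kap
                 * min lam (2 * mu / (\<bar>1 - mu\<bar> + sqrt ((1 - mu)\<^sup>2 + 4 * mu * (1 - th\<^sup>2))))"
    and nu': "nu' = (if (lam = 2 \<and> mu = 2) \<or> L = UNIV then nu
                 else min nu (al * (lam + mu - lam * mu)))"
begin

abbreviation "N \<equiv> orthogonal_comp (direction_space L)"
abbreviation "rad \<equiv> sqrt 2 * del"

lemma subset_L: "A \<subseteq> L" "B \<subseteq> L" and affine_L: "affine L" and w_L: "w \<in> L"
  using hull_subset[of "A \<union> B" affine] wA unfolding L by auto

lemma N_inner: "n \<in> N \<Longrightarrow> y \<in> L \<Longrightarrow> z \<in> L \<Longrightarrow> n \<bullet> (y - z) = 0"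
  by (simp add: orthogonal_comp_direction_space)

lemma N_scale: "n \<in> N \<Longrightarrow> t *\<^sub>R n \<in> N"
  using subspace_orthogonal_comp subspace_scale by blast

lemma proj_normal:
  assumes "n \<in> N"
  shows "projector A (x + n) = projector A x" "projector B (x + n) = projector B x"
  using projector_add_normal[OF subset_L(1) assms] projector_add_normal[OF subset_L(2) assms] by auto

lemma N_pythagoras:
  assumes "n \<in> N" "y \<in> L" "z \<in> L"
  shows "(norm (t *\<^sub>R n + s *\<^sub>R (y - z)))\<^sup>2 = t\<^sup>2 * (norm n)\<^sup>2 + s\<^sup>2 * (norm (y - z))\<^sup>2"
  using N_inner[OF assms] by (simp only: norm_scaleR_add_power2) (simp add: power_mult_distrib)

lemma be_nonneg: "0 \<le> be" unfolding be using lam mu by simp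

section \<open>The set of target points of one operator\<close>

lemma Z_simps:
  "lam = 2 \<and> mu = 2 \<Longrightarrow> Z = (A \<inter> B) + N"
  "\<not> (lam = 2 \<and> mu = 2) \<Longrightarrow> Z = A \<inter> B"
  by (rule trans[OF Z if_P], assumption) (rule trans[OF Z if_not_P], assumption)

text \<open>Brings both cases of \<open>Z\<close> into one shape. Under either alternative of the
  last clause, multiplying \<open>n\<close> by \<open>(1 - mu) * (1 - lam)\<close> leaves it
  unchanged, so the arguments using this need no case distinction.\<close>

lemma ZE:
  assumes "z \<in> Z"
  obtains c n where "c \<in> A \<inter> B" "n \<in> N" "z = c + n" "n = 0 \<or> lam = 2 \<and> mu = 2"
proof (cases "lam = 2 \<and> mu = 2")
  case True
  then have "z \<in> (A \<inter> B) + N" using assms Z_simps by simp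
  then show ?thesis using that True by (meson set_plus_elim)
next
  case False
  then have "z \<in> A \<inter> B" using assms Z_simps by simp
  moreover have "0 \<in> N" by (rule subspace_0[OF subspace_orthogonal_comp])
  ultimately show ?thesis using that[of z 0] by simp
qed

lemma w_Z: "w \<in> Z"
proof -
  have "0 \<in> N" by (rule subspace_0[OF subspace_orthogonal_comp])
  then have "w + 0 \<in> (A \<inter> B) + N" using wA wB by blast
  then show ?thesis using wA wB Z_simps by (cases "lam = 2 \<and> mu = 2") auto
qed

text \<open>A Minkowski sum of two closed sets need not be closed. This one is, being the preimage
  of the closed set \<open>A \<inter> B\<close> under the continuous projection onto
  \<open>L\<close>.\<close>

lemma Z_closed: "closed Z"
proof (cases "lam = 2 \<and> mu = 2")
  case True
  have L': "convex L" "closed L" "L \<noteq> {}"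
    using affine_L w_L by (auto simp: affine_imp_convex affine_closed)
  have "Z = closest_point L -` (A \<inter> B)"
  proof (intro set_eqI iffI)
    fix z assume "z \<in> Z"
    then obtain c n where "c \<in> A \<inter> B" "n \<in> N" "z = c + n" by (rule ZE)
    then show "z \<in> closest_point L -` (A \<inter> B)"
      using closest_point_affine_unique[OF affine_L, of c n] subset_L by auto
  next
    fix z assume "z \<in> closest_point L -` (A \<inter> B)"
    moreover have "z = closest_point L z + (z - closest_point L z)" by simp
    ultimately have "z \<in> (A \<inter> B) + N"
      using closest_point_affine_normal[OF affine_L L'(3), of z] by (metis set_plus_intro vimage_eq)
    then show "z \<in> Z" using True by (simp only: Z_simps)
  qed
  moreover have "closed (closest_point L -` (A \<inter> B))"
    by (intro continuous_closed_vimage continuous_at_closest_point L') (use closedA closedB in auto)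
  ultimately show ?thesis by simp
next
  case False
  show ?thesis using closed_Int[OF closedA closedB] Z_simps(2)[OF False] by (simp only:)
qed

lemma projector_Z:
  assumes "c \<in> A \<inter> B" "n \<in> N"
  shows "projector A (c + n) = {c}" "projector B (c + n) = {c}"
  using assms by (auto simp: proj_normal projector_self)

text \<open>The normal part of \<open>z\<close> is invisible to both projectors. In the final
  theorem this links the projections onto the two endpoints of an edge of the graph.\<close>

lemma Z_projector_eq:
  assumes "z \<in> Z"
  shows "\<exists>c \<in> A \<inter> B. projector A z = {c} \<and> projector B z = {c}"
  using assms by (rule ZE) (use projector_Z in blast)

lemma Z_Fix: "Z \<subseteq> Fix (DR_operator al lam mu A B)"
proof
  fix z assume "z \<in> Z"
  then obtain c n where c: "c \<in> A \<inter> B" "n \<in> N" "z = c + n" "n = 0 \<or> lam = 2 \<and> mu = 2" by (rule ZE)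
  have r: "(1 - lam) *\<^sub>R z + lam *\<^sub>R c = c + (1 - lam) *\<^sub>R n"
    unfolding c by (simp add: algebra_simps)
  have "c \<in> projector A z" using c projector_Z by simp
  moreover have "c \<in> projector B ((1 - lam) *\<^sub>R z + lam *\<^sub>R c)"
    unfolding r using c projector_Z N_scale by simp
  moreover have "z = (1 - al) *\<^sub>R z + al *\<^sub>R ((1 - mu) *\<^sub>R ((1 - lam) *\<^sub>R z + lam *\<^sub>R c) + mu *\<^sub>R c)"
  proof -
    have "(1 - mu) *\<^sub>R (c + (1 - lam) *\<^sub>R n) + mu *\<^sub>R c = c + ((1 - mu) * (1 - lam)) *\<^sub>R n"
      by (simp add: algebra_simps)
    \<comment> \<open>Either \<open>n = 0\<close>, or both parameters are 2 and the coefficient is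
      \<open>(-1) * (-1)\<close>.\<close>
    also have "\<dots> = z" using c(3,4) by auto
    finally show ?thesis unfolding r by (simp add: algebra_simps)
  qed
  ultimately have "z \<in> DR_operator al lam mu A B z" unfolding DR_operator_iff by blast
  then show "z \<in> Fix (DR_operator al lam mu A B)" by (simp add: Fix_def)
qed

lemma DR_nonempty: "DR_operator al lam mu A B x \<noteq> {}"
proof -
  obtain p where p: "p \<in> projector A x" using projector_nonempty closedA wA by blast
  obtain q where q: "q \<in> projector B ((1 - lam) *\<^sub>R x + lam *\<^sub>R p)"
    using projector_nonempty closedB wB by blast
  show ?thesis using p q DR_operator_iff by blast
qed

section \<open>Localization and the quasi-Fejer inequality\<close>

lemma relaxed_factor:
  assumes "0 < l" "l \<le> 2"
  shows "0 \<le> l * eps / (1 - eps)" "l * eps / (1 - eps) \<le> 1"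
proof -
  show "0 \<le> l * eps / (1 - eps)" using assms eps by simp
  have "l * eps \<le> 2 * eps" using assms eps by (intro mult_right_mono) auto
  \<comment> \<open>For \<open>l = 2\<close> this is precisely the condition
    \<open>eps \<le> 1/3\<close>.\<close>
  also have "\<dots> \<le> 1 - eps" using eps by simp
  finally show "l * eps / (1 - eps) \<le> 1" using eps by (simp add: pos_divide_le_eq)
qed

lemma gam_ge_1: "1 \<le> gam"
proof -
  have "1 * 1 \<le> (1 + lam * eps / (1 - eps)) * (1 + mu * eps / (1 - eps))"
    using relaxed_factor(1)[OF lam] relaxed_factor(1)[OF mu] by (intro mult_mono) auto
  then have "al * 1 \<le> al * ((1 + lam * eps / (1 - eps)) * (1 + mu * eps / (1 - eps)))"
    using al by (intro mult_left_mono) auto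
  then show ?thesis unfolding gam by (simp add: mult.assoc)
qed

lemma regular_inner:
  assumes reg: "eps_delta_regular eps rad S w" and "p \<in> projector S x"
    and "p \<in> cball w rad" "c \<in> S" "c \<in> cball w rad"
  shows "- eps * norm (x - p) * norm (p - c) \<le> (x - p) \<bullet> (p - c)"
proof -
  have "x - p \<in> prox_normal_cone S p" using prox_normal_coneI[OF assms(2), of 1] by simp
  then show ?thesis using assms unfolding eps_delta_regular_def by (auto simp: projector_iff)
qed

lemma regular_relaxed_step:
  assumes "eps_delta_regular eps rad S w" "p \<in> projector S x" "p \<in> cball w rad" "c \<in> S" "c \<in> cball w rad" "0 \<le> l"
  shows "(norm ((1 - l) *\<^sub>R x + l *\<^sub>R p - c))\<^sup>2
    \<le> (1 + l * eps / (1 - eps)) * (norm (x - c))\<^sup>2 - l * (2 - l) * (norm (x - p))\<^sup>2"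
  using relaxed_step[OF regular_inner[OF assms(1-5)]] eps assms(6) by simp

text \<open>A plain projection at most doubles the distance to \<open>w\<close>, which places
  \<open>p\<close> within \<open>del\<close> without regularity. With \<open>p\<close> inside the
  regularity ball, the relaxed projection at most doubles the squared distance, so \<open>r\<close>
  is within \<open>rad / 2\<close>; projecting onto \<open>B\<close> doubles this to
  \<open>rad\<close>. Hence the factor \<open>sqrt 2\<close>.\<close>

lemma localization:
  assumes x: "x \<in> cball w (del / 2)" and p: "p \<in> projector A x"
    and q: "q \<in> projector B ((1 - lam) *\<^sub>R x + lam *\<^sub>R p)"
  shows "p \<in> cball w rad" "q \<in> cball w rad"
proof -
  define r where "r = (1 - lam) *\<^sub>R x + lam *\<^sub>R p"
  have rad: "del \<le> rad" using del by simp
  have x': "norm (x - w) \<le> del / 2" using x by (simp add: dist_norm norm_minus_commute)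
  have "norm (p - w) \<le> del" using projector_dist_le[OF p wA] x' by simp
  with rad show p': "p \<in> cball w rad" by (simp add: dist_norm norm_minus_commute)
  have "w \<in> cball w rad" using rad del by simp
  from regular_relaxed_step[OF regA p p' wA this, of lam]
  have "(norm (r - w))\<^sup>2 \<le> (1 + lam * eps / (1 - eps)) * (norm (x - w))\<^sup>2 - lam * (2 - lam) * (norm (x - p))\<^sup>2"
    using lam by (simp add: r_def)
  also have "\<dots> \<le> (1 + lam * eps / (1 - eps)) * (norm (x - w))\<^sup>2" using lam by simp
  also have "\<dots> \<le> 2 * (del / 2)\<^sup>2"
    using relaxed_factor[OF lam] x' by (intro mult_mono power_mono) auto
  also have "\<dots> = (rad / 2)\<^sup>2" by (simp add: power_mult_distrib power_divide)
  finally have "norm (r - w) \<le> rad / 2" by (rule power2_le_imp_le) (use del in simp)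
  with projector_dist_le[OF q[folded r_def] wB]
  show "q \<in> cball w rad" by (simp add: dist_norm norm_minus_commute)
qed

text \<open>Relative to \<open>x - s\<close>, averaging contributes the gain
  \<open>al * (1 - al)\<close>, negative for \<open>al > 1\<close>, and the two projections
  contribute \<open>al * be\<close>. Since \<open>x - x'\<close> is \<open>al\<close> times
  \<open>x - s\<close>, dividing by \<open>al^2\<close> gives the coefficient, and
  \<open>al < 1 + be\<close> keeps it positive.\<close>

lemma quasi_core:
  assumes p: "p \<in> projector A x" "p \<in> cball w rad"
    and q: "q \<in> projector B ((1 - lam) *\<^sub>R x + lam *\<^sub>R p)" "q \<in> cball w rad"
    and c: "c \<in> A \<inter> B" "c \<in> cball w rad"
    and x': "x' = (1 - al) *\<^sub>R x + al *\<^sub>R ((1 - mu) *\<^sub>R ((1 - lam) *\<^sub>R x + lam *\<^sub>R p) + mu *\<^sub>R q)"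
  shows "(norm (x' - c))\<^sup>2 \<le> gam * (norm (x - c))\<^sup>2 - (1 - al + be) / al * (norm (x - x'))\<^sup>2"
proof -
  define r where "r = (1 - lam) *\<^sub>R x + lam *\<^sub>R p"
  define s where "s = (1 - mu) *\<^sub>R r + mu *\<^sub>R q"
  define E F where "E = lam * eps / (1 - eps)" and "F = mu * eps / (1 - eps)"
  define a b where "a = norm (x - p)" and "b = norm (r - q)"
  define D where "D = (norm (x - c))\<^sup>2"
  define G where "G = (norm (r - c))\<^sup>2"
  have EF: "0 \<le> E" "0 \<le> F" using relaxed_factor lam mu by (auto simp: E_def F_def)
  have 1: "G \<le> (1 + E) * D - lam * (2 - lam) * a\<^sup>2"
    using regular_relaxed_step[OF regA p _ c(2), of lam] c lam
    by (simp add: r_def E_def D_def a_def G_def)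
  have 2: "(norm (s - c))\<^sup>2 \<le> (1 + F) * G - mu * (2 - mu) * b\<^sup>2"
    using regular_relaxed_step[OF regB q[folded r_def] _ c(2), of mu] c mu
    by (simp add: s_def F_def b_def G_def)
  have "(1 + F) * G \<le> (1 + F) * ((1 + E) * D - lam * (2 - lam) * a\<^sup>2)"
    using 1 EF by (intro mult_left_mono) auto
  also have "\<dots> \<le> (1 + E) * (1 + F) * D - lam * (2 - lam) * a\<^sup>2"
  proof -
    \<comment> \<open>The factor \<open>1 + F\<close> also enlarges the gain of the first
      projection; this surplus is dropped.\<close>
    have "0 \<le> F * (lam * (2 - lam) * a\<^sup>2)" using EF lam by simp
    then show ?thesis by (simp only: distrib_right distrib_left right_diff_distrib mult_1_left) (simp add: algebra_simps)
  qed
  finally have 3: "(norm (s - c))\<^sup>2 \<le> (1 + E) * (1 + F) * D - (lam * (2 - lam) * a\<^sup>2 + mu * (2 - mu) * b\<^sup>2)"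
    using 2 by linarith
  have "x - s = lam *\<^sub>R (x - p) + mu *\<^sub>R (r - q)" by (simp add: s_def r_def algebra_simps)
  then have "norm (x - s) \<le> lam * a + mu * b"
    using norm_triangle_ineq[of "lam *\<^sub>R (x - p)" "mu *\<^sub>R (r - q)"] lam mu by (simp add: a_def b_def)
  then have "be * (norm (x - s))\<^sup>2 \<le> be * (lam * a + mu * b)\<^sup>2"
    using be_nonneg by (intro mult_left_mono power_mono) auto
  also have "\<dots> \<le> lam * (2 - lam) * a\<^sup>2 + mu * (2 - mu) * b\<^sup>2"
    by (rule relaxation_harmonic_bound[OF lam mu be])
  finally have "(norm (s - c))\<^sup>2 \<le> (1 + E) * (1 + F) * D - be * (norm (x - s))\<^sup>2" using 3 by linarith
  then have 4: "al * (norm (s - c))\<^sup>2 \<le> al * ((1 + E) * (1 + F) * D - be * (norm (x - s))\<^sup>2)"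
    using al by (intro mult_left_mono) auto
  have x's: "x' = (1 - al) *\<^sub>R x + al *\<^sub>R s" by (simp add: x' s_def r_def)
  have "x' - c = (1 - al) *\<^sub>R (x - c) + al *\<^sub>R (s - c)" by (simp add: x's algebra_simps)
  then have "(norm (x' - c))\<^sup>2
      = (1 - al) * D + al * (norm (s - c))\<^sup>2 - al * (1 - al) * (norm (x - s))\<^sup>2"
    by (simp only: norm_affine_combination D_def) simp
  also have "\<dots> \<le> (1 - al) * D + al * ((1 + E) * (1 + F) * D - be * (norm (x - s))\<^sup>2)
      - al * (1 - al) * (norm (x - s))\<^sup>2" using 4 by linarith
  also have "\<dots> = gam * D - al * (1 - al + be) * (norm (x - s))\<^sup>2"
    unfolding gam E_def[symmetric] F_def[symmetric] by algebra
  also have "al * (1 - al + be) * (norm (x - s))\<^sup>2 = (1 - al + be) / al * (norm (x - x'))\<^sup>2"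
  proof -
    have "x - x' = al *\<^sub>R (x - s)" by (simp add: x's algebra_simps)
    then have "(norm (x - x'))\<^sup>2 = al\<^sup>2 * (norm (x - s))\<^sup>2" by (simp add: power_mult_distrib)
    then show ?thesis using al by (simp add: power2_eq_square)
  qed
  finally show ?thesis by (simp add: D_def)
qed

lemma quasi_Fejer:
  assumes x: "x \<in> cball w (del / 2)" and x': "x' \<in> DR_operator al lam mu A B x"
    and z: "z \<in> Z" "z \<in> cball w del"
  shows "(norm (x' - z))\<^sup>2 \<le> gam * (norm (x - z))\<^sup>2 - (1 - al + be) / al * (norm (x - x'))\<^sup>2"
proof -
  obtain c n where c: "c \<in> A \<inter> B" "n \<in> N" "z = c + n" "n = 0 \<or> lam = 2 \<and> mu = 2"
    using z(1) by (rule ZE)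
  obtain p q where p: "p \<in> projector A x" and q: "q \<in> projector B ((1 - lam) *\<^sub>R x + lam *\<^sub>R p)"
    and x'eq: "x' = (1 - al) *\<^sub>R x + al *\<^sub>R ((1 - mu) *\<^sub>R ((1 - lam) *\<^sub>R x + lam *\<^sub>R p) + mu *\<^sub>R q)"
    using x' unfolding DR_operator_iff by blast
  have "(norm (z - w))\<^sup>2 = (norm n)\<^sup>2 + (norm (c - w))\<^sup>2"
  proof -
    have "z - w = 1 *\<^sub>R n + 1 *\<^sub>R (c - w)" by (simp add: c(3))
    moreover have "c \<in> L" using c(1) subset_L by blast
    ultimately show ?thesis using N_pythagoras[OF c(2) _ w_L, of c 1 1] by (simp only:) simp
  qed
  then have "(norm (c - w))\<^sup>2 \<le> (norm (z - w))\<^sup>2" using zero_le_power2[of "norm n"] by linarith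
  then have "norm (c - w) \<le> norm (z - w)" by (rule power2_le_imp_le) (rule norm_ge_zero)
  moreover have "del \<le> rad" using del by simp
  ultimately have cw: "c \<in> cball w rad" using z(2) by (simp add: dist_norm norm_minus_commute)
  \<comment> \<open>Translation by \<open>- n\<close> reduces the claim to the point
    \<open>c\<close> of \<open>A \<inter> B\<close>: the same \<open>p\<close> and \<open>q\<close>
    are projections for the step from \<open>x - n\<close>, and that step ends at
    \<open>x' - n\<close>.\<close>
  have m1: "- n \<in> N" using N_scale[OF c(2), of "-1"] by simp
  have p2: "p \<in> projector A (x - n)" using p proj_normal(1)[OF m1, of x] by simp
  have "(1 - lam) *\<^sub>R (x - n) + lam *\<^sub>R p = ((1 - lam) *\<^sub>R x + lam *\<^sub>R p) + (lam - 1) *\<^sub>R n"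
    by (simp add: algebra_simps)
  then have q2: "q \<in> projector B ((1 - lam) *\<^sub>R (x - n) + lam *\<^sub>R p)"
    using q proj_normal(2)[OF N_scale[OF c(2), of "lam - 1"]] by (simp only:)
  have x2: "x' - n =  (1 - al) *\<^sub>R (x - n)
      + al *\<^sub>R ((1 - mu) *\<^sub>R ((1 - lam) *\<^sub>R (x - n) + lam *\<^sub>R p) + mu *\<^sub>R q)"
  proof -
    have "(1 - al) *\<^sub>R (x - n)
      + al *\<^sub>R ((1 - mu) *\<^sub>R ((1 - lam) *\<^sub>R (x - n) + lam *\<^sub>R p) + mu *\<^sub>R q) = x' - ((1 - al) + al * ((1 - mu) * (1 - lam))) *\<^sub>R n"
      unfolding x'eq by (simp add: algebra_simps)
    also have "((1 - al) + al * ((1 - mu) * (1 - lam))) *\<^sub>R n = n" using c(4) by auto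
    finally show ?thesis by (rule sym)
  qed
  \<comment> \<open>\<open>localization\<close> is applied at \<open>x\<close>, because
    \<open>x - n\<close> need not lie in the ball of radius \<open>del / 2\<close>.\<close>
  from quasi_core[OF p2 localization(1)[OF x p q] q2 localization(2)[OF x p q] c(1) cw x2]
  show ?thesis by (simp add: c(3) diff_diff_eq add.commute)
qed

section \<open>The CQ-number and the lower bound for the step length\<close>

lemma CQ_bdd:
  "bdd_above {u \<bullet> v | u v a b.
       a \<in> A \<inter> cball w rad \<and> u \<in> prox_normal_cone A a \<inter> (\<lambda>z. z - a) ` L \<inter> cball 0 1 \<and>
       b \<in> B \<inter> cball w rad \<and> v \<in> uminus ` prox_normal_cone B b \<inter> (\<lambda>z. z - b) ` L \<inter> cball 0 1}"
proof (rule bdd_aboveI[of _ 1])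
  fix t assume "t \<in> {u \<bullet> v | u v a b.
       a \<in> A \<inter> cball w rad \<and> u \<in> prox_normal_cone A a \<inter> (\<lambda>z. z - a) ` L \<inter> cball 0 1 \<and>
       b \<in> B \<inter> cball w rad \<and> v \<in> uminus ` prox_normal_cone B b \<inter> (\<lambda>z. z - b) ` L \<inter> cball 0 1}"
  then obtain u v :: 'a where uv: "t = u \<bullet> v" and "u \<in> cball 0 1" "v \<in> cball 0 1"
    by blast
  then have uv': "norm u \<le> 1" "norm v \<le> 1" by auto
  have "u \<bullet> v \<le> norm u * norm v" by (rule norm_cauchy_schwarz)
  also have "\<dots> \<le> 1 * 1" using uv' by (intro mult_mono) auto
  finally show "t \<le> 1" using uv by simp
qed

lemma CQ_upper:
  assumes "a \<in> A" "a \<in> cball w rad" "u \<in> prox_normal_cone A a" "a + u \<in> L" "norm u \<le> 1"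
    and "b \<in> B" "b \<in> cball w rad" "- v \<in> prox_normal_cone B b" "b + v \<in> L" "norm v \<le> 1"
  shows "u \<bullet> v \<le> th"
proof -
  have "u = (a + u) - a" "v = (b + v) - b" by auto
  then have "u \<in> (\<lambda>z. z - a) ` L" "v \<in> (\<lambda>z. z - b) ` L" using assms by blast+
  moreover have "v \<in> uminus ` prox_normal_cone B b" using assms by (metis image_eqI minus_minus)
  moreover have "u \<in> cball 0 1" "v \<in> cball 0 1" using assms by auto
  ultimately show ?thesis unfolding th CQ_number_def
    using assms by (intro cSup_upper[OF _ CQ_bdd]) blast
qed

lemma th_nonneg: "0 \<le> th"
proof -
  have "0 \<in> prox_normal_cone A w" "0 \<in> prox_normal_cone B w"
    using prox_normal_coneI[of w A w 0] prox_normal_coneI[of w B w 0] wA wB by (auto simp: projector_self)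
  then show ?thesis using CQ_upper[of w 0 w 0] wA wB w_L del by simp
qed

text \<open>The two displacements, scaled to length 1, compete in the supremum. The points
  \<open>x\<close> and \<open>r\<close> must lie in \<open>L\<close> for the scaled vectors to be
  parallel to \<open>L\<close>.\<close>

lemma inner_le_th:
  assumes "x \<in> L" "r \<in> L" "p \<in> projector A x" "p \<in> cball w rad" "q \<in> projector B r" "q \<in> cball w rad"
  shows "(x - p) \<bullet> (q - r) \<le> th * (norm (x - p) * norm (q - r))"
proof (cases "x = p \<or> q = r")
  case True
  then show ?thesis by auto
next
  case False
  define f g where "f = norm (x - p)" and "g = norm (q - r)"
  have fg: "0 < f" "0 < g" using False by (auto simp: f_def g_def)
  have pA: "p \<in> A" "p \<in> L" "q \<in> B" "q \<in> L" using assms subset_L by (auto simp: projector_iff)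
  have "((1/f) *\<^sub>R (x - p)) \<bullet> ((1/g) *\<^sub>R (q - r)) \<le> th"
  proof (rule CQ_upper[OF pA(1) assms(4) _ _ _ pA(3) assms(6)])
    show "(1/f) *\<^sub>R (x - p) \<in> prox_normal_cone A p" using assms fg by (intro prox_normal_coneI) auto
    have "- ((1/g) *\<^sub>R (q - r)) = (1/g) *\<^sub>R (r - q)" by (simp add: algebra_simps)
    then show "- ((1/g) *\<^sub>R (q - r)) \<in> prox_normal_cone B q"
      using assms fg prox_normal_coneI[of q B r "1/g"] by simp
    show "p + (1/f) *\<^sub>R (x - p) \<in> L" "q + (1/g) *\<^sub>R (q - r) \<in> L"
      using mem_affine_3_minus[OF affine_L] pA assms by auto
    show "norm ((1/f) *\<^sub>R (x - p)) \<le> 1" "norm ((1/g) *\<^sub>R (q - r)) \<le> 1"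
      using fg by (auto simp: f_def g_def)
  qed
  moreover have "((1/f) *\<^sub>R (x - p)) \<bullet> ((1/g) *\<^sub>R (q - r)) = ((x - p) \<bullet> (q - r)) / (f * g)"
    by (simp only: inner_scaleR_left inner_scaleR_right) simp
  ultimately have "((x - p) \<bullet> (q - r)) / (f * g) \<le> th" by (simp only:)
  then show ?thesis using fg by (simp add: f_def[symmetric] g_def[symmetric] pos_divide_le_eq)
qed

lemma th_square: "0 < 1 - th\<^sup>2"
  using th_nonneg th_less by (simp add: abs_square_less_1)

lemma nu_nonneg: "0 \<le> nu"
proof -
  have "0 \<le> \<bar>1 - mu\<bar> + sqrt ((1 - mu)\<^sup>2 + 4 * mu * (1 - th\<^sup>2))" using th_square mu by simp
  then show ?thesis unfolding nu using al kap th_square mu lam by simp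
qed

text \<open>The expression is \<open>1 - (1 - lam) * (1 - mu)\<close>, and both factors have modulus
  at most 1.\<close>

lemma relax_gap_nonneg: "0 \<le> lam + mu - lam * mu"
proof -
  have "\<bar>(1 - lam) * (1 - mu)\<bar> \<le> 1 * 1" unfolding abs_mult using lam mu by (intro mult_mono) auto
  then have "(1 - lam) * (1 - mu) \<le> 1" by linarith
  then show ?thesis by (simp add: algebra_simps)
qed

lemma nu'_nonneg: "0 \<le> nu'"
  unfolding nu' using nu_nonneg relax_gap_nonneg al by simp

text \<open>Here \<open>x - s\<close> is \<open>lam\<close> times \<open>u\<close> minus
  \<open>mu\<close> times \<open>v\<close>, while \<open>x - q\<close> is \<open>lam\<close> times
  \<open>u\<close> minus \<open>v\<close>. The angle bound controls \<open>norm u\<close>, the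
  distance to \<open>A\<close>, and \<open>norm (x - q)\<close>, at least the distance to
  \<open>B\<close>, by \<open>norm (x - s)\<close>. These two estimates yield the two entries of the
  minimum in \<open>nu\<close>.\<close>

lemma coercive_in_L:
  assumes x: "x \<in> cball w (del / 2)" "x \<in> L" and p: "p \<in> projector A x"
    and q: "q \<in> projector B ((1 - lam) *\<^sub>R x + lam *\<^sub>R p)"
    and s: "s = (1 - mu) *\<^sub>R ((1 - lam) *\<^sub>R x + lam *\<^sub>R p) + mu *\<^sub>R q"
  shows "nu * infdist x (A \<inter> B) \<le> al * norm (x - s)"
proof -
  define r where "r = (1 - lam) *\<^sub>R x + lam *\<^sub>R p"
  define u v where "u = x - p" and "v = q - r"
  define a b c where "a = lam * norm u" and "b = norm v" and "c = lam * (u \<bullet> v)"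
  define k where "k = 2 * mu / (\<bar>1 - mu\<bar> + sqrt ((1 - mu)\<^sup>2 + 4 * mu * (1 - th\<^sup>2)))"
  define \<tau> where "\<tau> = 1 - th\<^sup>2"
  have \<tau>: "0 < \<tau>" using th_square by (simp add: \<tau>_def)
  have k: "0 \<le> k" unfolding k_def using mu th_square by simp
  have "p \<in> L" using p subset_L by (auto simp: projector_iff)
  then have "r \<in> L" unfolding r_def using mem_affine[OF affine_L x(2), of p "1 - lam" lam] by simp
  from inner_le_th[OF x(2) this p localization(1)[OF x(1) p q] q[folded r_def] localization(2)[OF x(1) p q]]
  have "u \<bullet> v \<le> th * (norm u * norm v)" by (simp add: u_def v_def)
  then have "lam * (u \<bullet> v) \<le> lam * (th * (norm u * norm v))" using lam by (intro mult_left_mono) auto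
  then have c_le: "c \<le> th * (a * b)" by (simp add: a_def b_def c_def algebra_simps)
  have ab: "0 \<le> a" "0 \<le> b" using lam by (auto simp: a_def b_def)
  have xs: "x - s = lam *\<^sub>R u + (- mu) *\<^sub>R v"
    unfolding s r_def[symmetric] by (simp add: u_def v_def r_def algebra_simps)
  have xs2: "(norm (x - s))\<^sup>2 = a\<^sup>2 + mu\<^sup>2 * b\<^sup>2 - 2 * mu * c"
    unfolding xs norm_scaleR_add_power2 by (simp add: a_def b_def c_def power_mult_distrib)
  have xq: "x - q = lam *\<^sub>R u + (- 1) *\<^sub>R v"
    by (simp add: u_def v_def r_def algebra_simps)
  have xq2: "(norm (x - q))\<^sup>2 = a\<^sup>2 + b\<^sup>2 - 2 * c"
    unfolding xq norm_scaleR_add_power2 by (simp add: a_def b_def c_def power_mult_distrib)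
  have "\<tau> * k\<^sup>2 * (norm (x - q))\<^sup>2 \<le> (norm (x - s))\<^sup>2"
    unfolding xs2 xq2 \<tau>_def
    by (rule second_reflection_ratio[OF mu(1) th_nonneg th_less ab c_le k_def])
  then have "(sqrt \<tau> * k * norm (x - q))\<^sup>2 \<le> (norm (x - s))\<^sup>2" using \<tau> by (simp add: power_mult_distrib)
  then have 1: "sqrt \<tau> * k * norm (x - q) \<le> norm (x - s)" by (rule power2_le_imp_le) simp
  \<comment> \<open>Completing the square minimises the squared step length over \<open>b\<close>;
    the minimum \<open>\<tau> * a^2\<close> is attained at \<open>mu * b = th * a\<close>.\<close>
  have "mu * c \<le> mu * (th * (a * b))" using c_le mu by (intro mult_left_mono) auto
  moreover have "0 \<le> (th * a - mu * b)\<^sup>2" by simp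
  moreover have "(th * a - mu * b)\<^sup>2 = a\<^sup>2 + mu\<^sup>2 * b\<^sup>2 - 2 * (mu * (th * (a * b))) - \<tau> * a\<^sup>2"
    unfolding \<tau>_def by algebra
  ultimately have "\<tau> * a\<^sup>2 \<le> (norm (x - s))\<^sup>2" unfolding xs2 by linarith
  then have "(sqrt \<tau> * a)\<^sup>2 \<le> (norm (x - s))\<^sup>2" using \<tau> by (simp add: power_mult_distrib)
  then have 2: "sqrt \<tau> * a \<le> norm (x - s)" by (rule power2_le_imp_le) simp
  have "q \<in> B" using q by (simp add: projector_iff)
  then have dB: "infdist x B \<le> norm (x - q)" using infdist_le[of q B x] by (simp add: dist_norm)
  have dA: "infdist x A = norm u" using p by (simp add: projector_def u_def)
  have min0: "0 \<le> min lam k" using lam k by simp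
  have A: "sqrt \<tau> * (min lam k * infdist x A) \<le> norm (x - s)"
  proof -
    have "min lam k * infdist x A \<le> a" unfolding dA a_def by (intro mult_right_mono) auto
    then have "sqrt \<tau> * (min lam k * infdist x A) \<le> sqrt \<tau> * a" using \<tau> by (intro mult_left_mono) auto
    with 2 show ?thesis by simp
  qed
  have B: "sqrt \<tau> * (min lam k * infdist x B) \<le> norm (x - s)"
  proof -
    have "min lam k * infdist x B \<le> k * norm (x - q)"
      using dB min0 k by (intro mult_mono) (auto simp: infdist_nonneg)
    then have "sqrt \<tau> * (min lam k * infdist x B) \<le> sqrt \<tau> * (k * norm (x - q))"
      using \<tau> by (intro mult_left_mono) auto
    with 1 show ?thesis by (simp add: mult.assoc)
  qed
  have nu_eq: "nu = al * (sqrt \<tau> * min lam k) / kap" by (simp add: nu k_def \<tau>_def)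
  have "nu * infdist x (A \<inter> B) \<le> nu * (kap * max (infdist x A) (infdist x B))"
    using lin[OF x(1)] nu_nonneg by (intro mult_left_mono) auto
  also have "\<dots> = al * (sqrt \<tau> * (min lam k * max (infdist x A) (infdist x B)))"
    using kap by (simp add: nu_eq)
  also have "\<dots> \<le> al * norm (x - s)"
    using A B al by (intro mult_left_mono) (auto simp: max_def)
  finally show ?thesis .
qed

text \<open>With \<open>x\<close> split into its projection \<open>y\<close> onto \<open>L\<close>
  and a normal part \<open>n\<close>, the displacement \<open>x - x'\<close> splits orthogonally
  into \<open>g\<close> times \<open>n\<close> and the displacement of the step from
  \<open>y\<close>.\<close>

lemma coercive:
  assumes x: "x \<in> cball w (del / 2)" and x': "x' \<in> DR_operator al lam mu A B x"
  shows "nu' * infdist x Z \<le> norm (x - x')"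
proof -
  obtain p q where p: "p \<in> projector A x" and q: "q \<in> projector B ((1 - lam) *\<^sub>R x + lam *\<^sub>R p)"
    and x'eq: "x' = (1 - al) *\<^sub>R x + al *\<^sub>R ((1 - mu) *\<^sub>R ((1 - lam) *\<^sub>R x + lam *\<^sub>R p) + mu *\<^sub>R q)"
    using x' unfolding DR_operator_iff by blast
  define y where "y = closest_point L x"
  define n where "n = x - y"
  have y: "y \<in> L" using affine_L w_L by (auto simp: y_def intro!: closest_point_in_set affine_closed)
  have n: "n \<in> N" using closest_point_affine_normal[OF affine_L, of x] w_L by (auto simp: n_def y_def)
  have x_eq: "x = y + n" by (simp add: n_def)
  have pyth: "(norm (x - z))\<^sup>2 = (norm n)\<^sup>2 + (norm (y - z))\<^sup>2" if "z \<in> L" for z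
    using N_pythagoras[OF n y that, of 1 1] by (simp add: x_eq algebra_simps)
  have "(norm (y - w))\<^sup>2 \<le> (norm (x - w))\<^sup>2"
    using pyth[OF w_L] zero_le_power2[of "norm n"] by linarith
  then have "norm (y - w) \<le> norm (x - w)" by (rule power2_le_imp_le) (rule norm_ge_zero)
  then have yb: "y \<in> cball w (del / 2)" using x by (simp add: dist_norm norm_minus_commute)
  have p1: "p \<in> projector A y" using p proj_normal(1)[OF n] by (simp add: x_eq)
  have "(1 - lam) *\<^sub>R x + lam *\<^sub>R p = ((1 - lam) *\<^sub>R y + lam *\<^sub>R p) + (1 - lam) *\<^sub>R n"
    by (simp add: x_eq algebra_simps)
  then have q1: "q \<in> projector B ((1 - lam) *\<^sub>R y + lam *\<^sub>R p)"
    using q proj_normal(2)[OF N_scale[OF n, of "1 - lam"]] by (simp only:)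
  define s where "s = (1 - mu) *\<^sub>R ((1 - lam) *\<^sub>R y + lam *\<^sub>R p) + mu *\<^sub>R q"
  have pq: "p \<in> L" "q \<in> L" using p q subset_L by (auto simp: projector_iff)
  have "(1 - lam) *\<^sub>R y + lam *\<^sub>R p \<in> L" using mem_affine[OF affine_L y pq(1), of "1 - lam" lam] by simp
  then have sL: "s \<in> L" unfolding s_def using mem_affine[OF affine_L _ pq(2), of _ "1 - mu" mu] by simp
  define g where "g = al * (lam + mu - lam * mu)"
  define d where "d = infdist y (A \<inter> B)"
  have core: "nu * d \<le> al * norm (y - s)" unfolding d_def
    by (rule coercive_in_L[OF yb y p1 q1 s_def])
  have "x - x' = g *\<^sub>R n + al *\<^sub>R (y - s)"
    unfolding x'eq s_def g_def x_eq by (simp add: algebra_simps)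
  then have xx': "(norm (x - x'))\<^sup>2 = g\<^sup>2 * (norm n)\<^sup>2 + al\<^sup>2 * (norm (y - s))\<^sup>2"
    using N_pythagoras[OF n y sL] by simp
  have g0: "0 \<le> g" using relax_gap_nonneg al by (simp add: g_def)
  have "(al * norm (y - s))\<^sup>2 \<le> (norm (x - x'))\<^sup>2" unfolding xx' by (simp add: power_mult_distrib)
  then have ge_s: "al * norm (y - s) \<le> norm (x - x')" by (rule power2_le_imp_le) simp
  obtain c where c: "c \<in> A \<inter> B" "d = norm (y - c)"
    using infdist_attains_inf[of "A \<inter> B" y] closedA closedB wA wB by (auto simp: d_def dist_norm)
  have cL: "c \<in> L" using c subset_L by blast
  \<comment> \<open>In the first case \<open>g = 0\<close>, so nothing is gained from
    \<open>n\<close>, but \<open>Z\<close> contains \<open>c + n\<close>. In the second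
    \<open>n = 0\<close>. In the third the orthogonal parts are bounded separately, with constants
    \<open>g\<close> and \<open>nu\<close>.\<close>
  consider "lam = 2 \<and> mu = 2" | "\<not> (lam = 2 \<and> mu = 2)" "L = UNIV" | "\<not> (lam = 2 \<and> mu = 2)" "L \<noteq> UNIV" by blast
  then show ?thesis
  proof cases
    case 1
    then have "c + n \<in> Z" using c(1) n by (simp only: Z_simps set_plus_intro)
    then have "infdist x Z \<le> d" using infdist_le[of "c + n" Z x] c by (simp add: dist_norm x_eq)
    then have "nu * infdist x Z \<le> nu * d" using nu_nonneg by (rule mult_left_mono)
    then show ?thesis using 1 core ge_s by (simp add: nu')
  next
    case 2
    have "n \<bullet> (n - 0) = 0" using N_inner[OF n] 2(2) by blast
    then have "x = y" by (simp add: x_eq)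
    then show ?thesis using 2 core ge_s Z_simps(2) by (auto simp: nu' d_def)
  next
    case 3
    have cZ: "c \<in> Z" using c(1) Z_simps(2)[OF 3(1)] by (simp only:)
    have nu'le: "nu' \<le> nu" "nu' \<le> g" using 3 by (auto simp: nu' g_def)
    have "infdist x Z \<le> norm (x - c)" using infdist_le[OF cZ, of x] by (simp add: dist_norm)
    then have "nu' * infdist x Z \<le> nu' * norm (x - c)" using nu'_nonneg by (rule mult_left_mono)
    moreover have "nu' * norm (x - c) \<le> norm (x - x')"
    proof (rule power2_le_imp_le)
      have "(nu' * norm (x - c))\<^sup>2 = nu'\<^sup>2 * (norm n)\<^sup>2 + (nu' * d)\<^sup>2"
        unfolding power_mult_distrib pyth[OF cL] c(2) by (simp add: algebra_simps)
      also have "nu' * d \<le> al * norm (y - s)"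
        using core nu'le mult_right_mono[of nu' nu d] by (simp add: d_def infdist_nonneg)
      then have "nu'\<^sup>2 * (norm n)\<^sup>2 + (nu' * d)\<^sup>2 \<le> g\<^sup>2 * (norm n)\<^sup>2 + (al * norm (y - s))\<^sup>2"
        using nu'le nu'_nonneg
        by (intro add_mono mult_right_mono power_mono) (auto simp: d_def infdist_nonneg)
      also have "\<dots> = (norm (x - x'))\<^sup>2" by (simp add: xx' power_mult_distrib)
      finally show "(nu' * norm (x - c))\<^sup>2 \<le> (norm (x - x'))\<^sup>2" .
    qed simp
    ultimately show ?thesis by linarith
  qed
qed

end

subsection \<open>Cyclic quasi-Fejer operators\<close>

lemma geometric_steps_limit:
  fixes f :: "nat \<Rightarrow> 'a::banach"
  assumes q: "0 \<le> q" "q < 1" and step: "\<And>n. norm (f (Suc n) - f n) \<le> K * q ^ n"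
  obtains y where "f \<longlonglongrightarrow> y" "\<And>n. norm (f n - y) \<le> K / (1 - q) * q ^ n"
proof -
  define M where "M = K / (1 - q)"
  have K: "K = M * (1 - q)" using q by (simp add: M_def)
  have K0: "0 \<le> K" using order_trans[OF norm_ge_zero step[of 0]] by simp
  then have M0: "0 \<le> M" using q by (simp add: M_def)
  have close: "norm (f (n + k) - f n) \<le> M * (q ^ n - q ^ (n + k))" for n k
  proof (induction k)
    case (Suc k)
    have "norm (f (n + Suc k) - f n) \<le> norm (f (Suc (n + k)) - f (n + k)) + norm (f (n + k) - f n)"
      using norm_triangle_ineq[of "f (Suc (n + k)) - f (n + k)" "f (n + k) - f n"] by simp
    also have "\<dots> \<le> K * q ^ (n + k) + M * (q ^ n - q ^ (n + k))"
      using step[of "n + k"] Suc by linarith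
    also have "\<dots> = M * (q ^ n - q ^ (n + Suc k))" unfolding K by (simp add: algebra_simps)
    finally show ?case .
  qed simp
  have close': "norm (f m - f n) \<le> M * q ^ n" if "n \<le> m" for m n
  proof -
    have "norm (f (n + (m - n)) - f n) \<le> M * (q ^ n - q ^ (n + (m - n)))" by (rule close)
    also have "\<dots> \<le> M * q ^ n" using M0 q by (intro mult_left_mono) auto
    finally show ?thesis using that by simp
  qed
  have lim0: "(\<lambda>n. M * q ^ n) \<longlonglongrightarrow> 0"
    using tendsto_mult_right_zero[OF LIMSEQ_realpow_zero[OF q]] by simp
  have "Cauchy f"
  proof (rule metric_CauchyI)
    fix e :: real assume "0 < e"
    then have "\<forall>\<^sub>F n in sequentially. M * q ^ n < e / 2" using order_tendstoD(2)[OF lim0, of "e/2"] by simp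
    then obtain n where n: "M * q ^ n < e / 2" by (auto simp: eventually_sequentially)
    have "dist (f i) (f j) < e" if "n \<le> i" "n \<le> j" for i j
      using close'[OF that(1)] close'[OF that(2)] n dist_triangle_half_l[of "f i" "f n" e "f j"]
      by (simp add: dist_norm norm_minus_commute)
    then show "\<exists>M. \<forall>m\<ge>M. \<forall>n\<ge>M. dist (f m) (f n) < e" by blast
  qed
  then obtain y where y: "f \<longlonglongrightarrow> y" using Cauchy_convergent convergent_def by blast
  have "norm (f n - y) \<le> M * q ^ n" for n
  proof -
    have "(\<lambda>m. norm (f m - f n)) \<longlonglongrightarrow> norm (y - f n)" by (intro tendsto_intros y)
    then have "norm (y - f n) \<le> M * q ^ n" by (rule LIMSEQ_le_const2) (use close' in blast)
    then show ?thesis by (simp add: norm_minus_commute)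
  qed
  with y show ?thesis using that by (simp add: M_def)
qed

text \<open>The origin of the sum in the rate: for \<open>c\<close> equal to
  \<open>(1 - \<alpha> + \<beta>) / \<alpha>\<close> the first factor is the sum of
  \<open>\<alpha> / (1 - \<alpha> + \<beta>)\<close>.\<close>

lemma sum_power2_le_weighted:
  fixes c e :: "nat \<Rightarrow> real"
  assumes "\<And>i. i \<in> I \<Longrightarrow> 0 < c i"
  shows "(\<Sum>i\<in>I. e i)\<^sup>2 \<le> (\<Sum>i\<in>I. 1 / c i) * (\<Sum>i\<in>I. c i * (e i)\<^sup>2)"
proof -
  have "(\<Sum>i\<in>I. (1 / sqrt (c i)) * (sqrt (c i) * e i))\<^sup>2
     \<le> (\<Sum>i\<in>I. (1 / sqrt (c i))\<^sup>2) * (\<Sum>i\<in>I. (sqrt (c i) * e i)\<^sup>2)"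
    by (rule Cauchy_Schwarz_ineq_sum)
  also have "(\<Sum>i\<in>I. (1 / sqrt (c i)) * (sqrt (c i) * e i)) = (\<Sum>i\<in>I. e i)"
    using assms by (intro sum.cong) (auto simp: less_imp_neq[symmetric])
  also have "(\<Sum>i\<in>I. (1 / sqrt (c i))\<^sup>2) = (\<Sum>i\<in>I. 1 / c i)"
    using assms by (intro sum.cong) (auto simp: power_divide less_imp_le)
  also have "(\<Sum>i\<in>I. (sqrt (c i) * e i)\<^sup>2) = (\<Sum>i\<in>I. c i * (e i)\<^sup>2)"
    using assms by (intro sum.cong) (auto simp: power_mult_distrib less_imp_le)
  finally show ?thesis .
qed

text \<open>Keeps from the operators only the two step estimates. Indices run from 0 to
  \<open>l - 1\<close>, so index \<open>k\<close> stands for operator \<open>k + 1\<close> of the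
  theorem.\<close>

locale cyclic_quasi_Fejer =
  fixes T :: "nat \<Rightarrow> 'a::euclidean_space \<Rightarrow> 'a set" and Z :: "nat \<Rightarrow> 'a set" and w :: 'a
    and del kap nu Gam rho :: real and l :: nat and g c :: "nat \<Rightarrow> real"
  assumes l: "0 < l" and del: "0 < del" and kap: "0 < kap" and nu: "0 \<le> nu" "nu \<le> 1"
    and Z_closed: "\<And>k. k < l \<Longrightarrow> closed (Z k)" and w_Z: "\<And>k. k < l \<Longrightarrow> w \<in> Z k"
    and T_nonempty: "\<And>k x. k < l \<Longrightarrow> T k x \<noteq> {}"
    and g: "\<And>k. k < l \<Longrightarrow> 1 \<le> g k" and c: "\<And>k. k < l \<Longrightarrow> 0 < c k"
    and quasi: "\<And>k x x' z. k < l \<Longrightarrow> x \<in> cball w (del / 2) \<Longrightarrow> x' \<in> T k x \<Longrightarrow> z \<in> Z k \<Longrightarrow> z \<in> cball w del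
        \<Longrightarrow> (norm (x' - z))\<^sup>2 \<le> g k * (norm (x - z))\<^sup>2 - c k * (norm (x - x'))\<^sup>2"
    and coercive: "\<And>k x x'. k < l \<Longrightarrow> x \<in> cball w (del / 2) \<Longrightarrow> x' \<in> T k x
        \<Longrightarrow> nu * infdist x (Z k) \<le> norm (x - x')"
    and regular: "\<And>x. x \<in> cball w (del / 2)
        \<Longrightarrow> infdist x (\<Inter>k<l. Z k) \<le> kap * Max ((\<lambda>k. infdist x (Z k)) ` {..<l})"
    and Gam: "Gam = sqrt (\<Prod>k<l. g k)"
    and rho: "rho = root (2 * l) (max 0 (Gam\<^sup>2 - nu\<^sup>2 / kap\<^sup>2 * inverse (\<Sum>k<l. 1 / c k)))"
    and rho_less: "rho < 1"
begin

definition "S = (\<Inter>k<l. Z k)"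
text \<open>The factor by which the first \<open>n\<close> operators of a cycle may enlarge squared
  distances.\<close>

definition "P n = (\<Prod>k<n. g k)"
text \<open>Chosen so that \<open>P (l - 1) * del0^2 = (del / 2)^2\<close>: every point of a cycle
  to which an operator is applied stays within \<open>del / 2\<close> of \<open>w\<close>. The last
  factor is divided out because the end of the cycle is not covered by this requirement.\<close>

definition "del0 = del / (2 * Gam) * sqrt (g (l - 1))"

lemma S_closed: "closed S" unfolding S_def using Z_closed by auto

lemma w_S: "w \<in> S" unfolding S_def using w_Z by auto

lemma P_Suc: "P (Suc n) = g n * P n" by (simp add: P_def)

lemma P_mono: "n \<le> k \<Longrightarrow> k \<le> l \<Longrightarrow> P n \<le> P k" and P_ge_1: "n \<le> l \<Longrightarrow> 1 \<le> P n"
proof -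
  show ge: "n \<le> l \<Longrightarrow> 1 \<le> P n" for n unfolding P_def by (rule prod_ge_1) (use g in auto)
  show "n \<le> k \<Longrightarrow> k \<le> l \<Longrightarrow> P n \<le> P k"
  proof (induction k rule: dec_induct)
    case (step k)
    have "1 * P k \<le> g k * P k" using g[of k] ge[of k] step by (intro mult_right_mono) auto
    then show ?case using step by (simp add: P_Suc)
  qed simp
qed

lemma Gam_square: "Gam\<^sup>2 = P l" and Gam_ge_1: "1 \<le> Gam"
  using P_ge_1[of l] by (auto simp: Gam P_def)

lemma rho_power: "rho ^ (2 * l) = max 0 (Gam\<^sup>2 - nu\<^sup>2 / kap\<^sup>2 * inverse (\<Sum>k<l. 1 / c k))"
  and rho_nonneg: "0 \<le> rho"
  unfolding rho using l by (auto simp: real_root_ge_zero)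

lemma del0_nonneg: "0 \<le> del0"
  unfolding del0_def using del Gam_ge_1 g[of "l - 1"] l by simp

lemma P_del0:
  assumes "k < l"
  shows "P k * del0\<^sup>2 \<le> (del / 2)\<^sup>2"
proof -
  have gl: "1 \<le> g (l - 1)" using g l by simp
  have "Gam\<^sup>2 = g (l - 1) * P (l - 1)" using P_Suc[of "l - 1"] l by (simp add: Gam_square)
  moreover have "del0\<^sup>2 * Gam\<^sup>2 = (del / 2)\<^sup>2 * g (l - 1)"
    using Gam_ge_1 gl by (simp add: del0_def power_mult_distrib power_divide)
  ultimately have "g (l - 1) * (P (l - 1) * del0\<^sup>2) = g (l - 1) * (del / 2)\<^sup>2" by (simp add: mult_ac)
  then have "P (l - 1) * del0\<^sup>2 = (del / 2)\<^sup>2" using gl by simp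
  moreover have "P k * del0\<^sup>2 \<le> P (l - 1) * del0\<^sup>2"
    using P_mono[of k "l - 1"] assms by (intro mult_right_mono) auto
  ultimately show ?thesis by simp
qed

lemma del0_le: "del0 \<le> del / 2"
proof (rule power2_le_imp_le)
  show "del0\<^sup>2 \<le> (del / 2)\<^sup>2" using P_del0[of 0] l by (simp add: P_def)
qed (use del in simp)

text \<open>Makes nearest points admissible in \<open>quasi\<close>, which speaks only of points
  within \<open>del\<close> of \<open>w\<close>.\<close>

lemma nearest_in_ball:
  assumes "closed R" "w \<in> R" "y \<in> cball w (del / 2)"
  obtains z where "z \<in> R" "z \<in> cball w del" "norm (y - z) = infdist y R"
proof -
  obtain z where z: "z \<in> projector R y" using projector_nonempty assms by blast
  have "norm (z - w) \<le> 2 * norm (y - w)" by (rule projector_dist_le[OF z assms(2)])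
  then have "z \<in> cball w del" using assms(3) by (simp add: dist_norm norm_minus_commute)
  with z that show ?thesis by (auto simp: projector_def)
qed

lemma Max_attained:
  obtains j where "j < l" "Max ((\<lambda>k. infdist x (Z k)) ` {..<l}) = infdist x (Z j)"
proof -
  have "Max ((\<lambda>k. infdist x (Z k)) ` {..<l}) \<in> (\<lambda>k. infdist x (Z k)) ` {..<l}"
    using l by (intro Max_in) auto
  then show ?thesis using that by auto
qed

section \<open>Estimates over a single cycle\<close>

context
  fixes y :: "nat \<Rightarrow> 'a"
  assumes y0: "y 0 \<in> cball w del0" and y_step: "\<And>k. k < l \<Longrightarrow> y (Suc k) \<in> T k (y k)"
begin

lemma cycle_in_ball: "k < l \<Longrightarrow> y k \<in> cball w (del / 2)"
proof -
  have ball: "y k \<in> cball w (del / 2)" if "(norm (y k - w))\<^sup>2 \<le> P k * del0\<^sup>2" "k < l" for k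
  proof -
    have "(norm (y k - w))\<^sup>2 \<le> (del / 2)\<^sup>2" using that P_del0[of k] by linarith
    then have "norm (y k - w) \<le> del / 2" by (rule power2_le_imp_le) (use del in simp)
    then show ?thesis by (simp add: dist_norm norm_minus_commute)
  qed
  have *: "k \<le> l \<Longrightarrow> (norm (y k - w))\<^sup>2 \<le> P k * del0\<^sup>2" for k
  proof (induction k)
    case 0
    then show ?case using y0 by (simp add: P_def dist_norm norm_minus_commute power_mono)
  next
    case (Suc k)
    then have k: "k < l" "(norm (y k - w))\<^sup>2 \<le> P k * del0\<^sup>2" by auto
    have "(norm (y (Suc k) - w))\<^sup>2 \<le> g k * (norm (y k - w))\<^sup>2 - c k * (norm (y k - y (Suc k)))\<^sup>2"
      using quasi[OF k(1) ball[OF k(2,1)] y_step[OF k(1)] w_Z[OF k(1)]] del by simp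
    also have "\<dots> \<le> g k * (norm (y k - w))\<^sup>2" using c[OF k(1)] by simp
    also have "\<dots> \<le> g k * (P k * del0\<^sup>2)" using k g[OF k(1)] by (intro mult_left_mono) auto
    finally show ?case by (simp add: P_Suc mult.assoc)
  qed
  show "k < l \<Longrightarrow> y k \<in> cball w (del / 2)" using ball * by simp
qed

lemma cycle_quasi:
  assumes z: "z \<in> S" "z \<in> cball w del"
  shows "k \<le> l \<Longrightarrow> (norm (y k - z))\<^sup>2 \<le> P k * (norm (y 0 - z))\<^sup>2 - (\<Sum>i<k. c i * (norm (y i - y (Suc i)))\<^sup>2)"
proof (induction k)
  case 0
  then show ?case by (simp add: P_def)
next
  case (Suc k)
  let ?E = "\<Sum>i<k. c i * (norm (y i - y (Suc i)))\<^sup>2"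
  have k: "k < l" using Suc by simp
  have E: "0 \<le> ?E" by (intro sum_nonneg) (use c k in \<open>auto simp: less_imp_le\<close>)
  have zk: "z \<in> Z k" using z(1) k by (auto simp: S_def)
  have "(norm (y (Suc k) - z))\<^sup>2 \<le> g k * (norm (y k - z))\<^sup>2 - c k * (norm (y k - y (Suc k)))\<^sup>2"
    using quasi[OF k cycle_in_ball[OF k] y_step[OF k] zk z(2)] .
  moreover have "g k * (norm (y k - z))\<^sup>2 \<le> g k * (P k * (norm (y 0 - z))\<^sup>2 - ?E)"
    using Suc g[OF k] by (intro mult_left_mono) auto
  \<comment> \<open>Gains already collected are only enlarged by the later factor, so they can be
    kept undiminished.\<close>
  moreover have "1 * ?E \<le> g k * ?E" using g[OF k] E by (intro mult_right_mono) auto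
  ultimately show ?case by (simp add: P_Suc algebra_simps)
qed

lemma cycle_bound:
  assumes z: "z \<in> S" "z \<in> cball w del" and k: "k \<le> l"
  shows "norm (y k - z) \<le> Gam * norm (y 0 - z)"
proof (rule power2_le_imp_le)
  have "0 \<le> (\<Sum>i<k. c i * (norm (y i - y (Suc i)))\<^sup>2)"
    by (intro sum_nonneg) (use c k in \<open>auto simp: less_imp_le\<close>)
  then have "(norm (y k - z))\<^sup>2 \<le> P k * (norm (y 0 - z))\<^sup>2" using cycle_quasi[OF z k] by linarith
  also have "\<dots> \<le> P l * (norm (y 0 - z))\<^sup>2" using P_mono[OF k] by (intro mult_right_mono) auto
  finally show "(norm (y k - z))\<^sup>2 \<le> (Gam * norm (y 0 - z))\<^sup>2" by (simp add: power_mult_distrib Gam_square)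
qed (use Gam_ge_1 in simp)

text \<open>Coercivity for \<open>Z j\<close> is available at \<open>y j\<close> only, so the
  distance from \<open>y 0\<close> is estimated along the path to \<open>y j\<close>. Because
  \<open>nu \<le> 1\<close>, the earlier steps and step \<open>j\<close> together are at most the
  total length.\<close>

lemma cycle_length: "nu * infdist (y 0) S \<le> kap * (\<Sum>i<l. norm (y i - y (Suc i)))"
proof -
  define e where "e i = norm (y i - y (Suc i))" for i
  have y0': "y 0 \<in> cball w (del / 2)" using cycle_in_ball l by simp
  have path: "norm (y 0 - y j) \<le> (\<Sum>i<j. e i)" for j
  proof (induction j)
    case (Suc j)
    have "norm (y 0 - y (Suc j)) \<le> norm (y 0 - y j) + norm (y j - y (Suc j))"
      using norm_triangle_ineq[of "y 0 - y j" "y j - y (Suc j)"] by simp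
    then show ?case using Suc by (simp add: e_def)
  qed simp
  have *: "nu * infdist (y 0) (Z j) \<le> (\<Sum>i<l. e i)" if j: "j < l" for j
  proof -
    have s0: "0 \<le> (\<Sum>i<j. e i)" by (intro sum_nonneg) (simp add: e_def)
    have "infdist (y 0) (Z j) \<le> infdist (y j) (Z j) + (\<Sum>i<j. e i)"
      using infdist_triangle[of "y 0" "Z j" "y j"] path[of j] by (simp add: dist_norm)
    then have "nu * infdist (y 0) (Z j) \<le> nu * (infdist (y j) (Z j) + (\<Sum>i<j. e i))"
      using nu by (intro mult_left_mono) auto
    also have "\<dots> \<le> e j + 1 * (\<Sum>i<j. e i)"
      unfolding distrib_left using coercive[OF j cycle_in_ball[OF j] y_step[OF j]] s0 nu
      by (intro add_mono mult_right_mono) (auto simp: e_def)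
    also have "\<dots> = (\<Sum>i<Suc j. e i)" by simp
    also have "\<dots> \<le> (\<Sum>i<l. e i)" using j by (intro sum_mono2) (auto simp: e_def)
    finally show ?thesis .
  qed
  obtain j where j: "j < l" "Max ((\<lambda>k. infdist (y 0) (Z k)) ` {..<l}) = infdist (y 0) (Z j)"
    by (rule Max_attained)
  have "infdist (y 0) S \<le> kap * infdist (y 0) (Z j)" using regular[OF y0'] j by (simp add: S_def)
  then have "nu * infdist (y 0) S \<le> nu * (kap * infdist (y 0) (Z j))" using nu by (intro mult_left_mono) auto
  also have "\<dots> = kap * (nu * infdist (y 0) (Z j))" by simp
  also have "\<dots> \<le> kap * (\<Sum>i<l. e i)" using *[OF j(1)] kap by (intro mult_left_mono) auto
  finally show ?thesis by (simp add: e_def)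
qed

text \<open>Both bounds come from \<open>cycle_quasi\<close> at one point \<open>z\<close>, nearest
  to \<open>y 0\<close> in \<open>S\<close>; the triangle inequality through \<open>z\<close> gives
  the second, which makes the cycle starts a Cauchy sequence.\<close>

lemma cycle_contraction:
  "infdist (y l) S \<le> rho ^ l * infdist (y 0) S"
  "norm (y l - y 0) \<le> (1 + rho ^ l) * infdist (y 0) S"
proof -
  define d where "d = infdist (y 0) S"
  define s where "s = (\<Sum>k<l. 1 / c k)"
  define E where "E = (\<Sum>i<l. c i * (norm (y i - y (Suc i)))\<^sup>2)"
  have d0: "0 \<le> d" by (simp add: d_def infdist_nonneg)
  have s0: "0 < s" unfolding s_def using l c by (intro sum_pos) auto
  have y0': "y 0 \<in> cball w (del / 2)" using cycle_in_ball l by simp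
  obtain z where z: "z \<in> S" "z \<in> cball w del" "norm (y 0 - z) = d"
    using nearest_in_ball[OF S_closed w_S y0'] d_def by metis
  have "nu / kap * d \<le> (\<Sum>i<l. norm (y i - y (Suc i)))"
    using cycle_length kap by (simp add: d_def pos_divide_le_eq mult.commute)
  then have "(nu / kap * d)\<^sup>2 \<le> (\<Sum>i<l. norm (y i - y (Suc i)))\<^sup>2"
    using nu kap d0 by (intro power_mono) auto
  also have "\<dots> \<le> s * E" unfolding s_def E_def by (rule sum_power2_le_weighted) (use c in auto)
  finally have "nu\<^sup>2 / kap\<^sup>2 * d\<^sup>2 \<le> s * E" by (simp add: power_mult_distrib power_divide)
  then have "inverse s * (nu\<^sup>2 / kap\<^sup>2 * d\<^sup>2) \<le> inverse s * (s * E)"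
    using s0 by (intro mult_left_mono) auto
  then have E: "nu\<^sup>2 / kap\<^sup>2 * inverse s * d\<^sup>2 \<le> E" using s0 by (simp add: mult_ac)
  have "(norm (y l - z))\<^sup>2 \<le> P l * d\<^sup>2 - E"
    using cycle_quasi[OF z(1,2), of l] by (simp add: z(3) E_def)
  also have "\<dots> \<le> (Gam\<^sup>2 - nu\<^sup>2 / kap\<^sup>2 * inverse s) * d\<^sup>2"
    using E by (simp add: Gam_square left_diff_distrib)
  also have "\<dots> \<le> rho ^ (2 * l) * d\<^sup>2" unfolding rho_power s_def by (intro mult_right_mono) auto
  also have "\<dots> = (rho ^ l * d)\<^sup>2" by (simp add: power_mult_distrib power_mult[symmetric] mult.commute)
  finally have yz: "norm (y l - z) \<le> rho ^ l * d"
    by (rule power2_le_imp_le) (use rho_nonneg d0 in simp)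
  then show "infdist (y l) S \<le> rho ^ l * infdist (y 0) S"
    using infdist_le[OF z(1), of "y l"] by (simp add: dist_norm d_def)
  have "norm (y l - y 0) \<le> norm (y l - z) + norm (y 0 - z)"
    using norm_triangle_ineq4[of "y l - z" "y 0 - z"] by simp
  then show "norm (y l - y 0) \<le> (1 + rho ^ l) * infdist (y 0) S"
    using yz z(3) by (simp add: d_def algebra_simps)
qed

end

lemma Gam_square_ge_factor:
  assumes "j < l"
  shows "g j \<le> Gam\<^sup>2"
proof -
  have "g j * 1 \<le> g j * P j" using g[OF assms] P_ge_1[of j] assms by (intro mult_left_mono) auto
  also have "\<dots> \<le> P l" using P_mono[of "Suc j" l] assms by (simp add: P_Suc)
  finally show ?thesis by (simp add: Gam_square)
qed

text \<open>A vanishing rate would force the whole tail of the sequence to be constant, which a single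
  cycle does not yield when \<open>l \<ge> 2\<close>. But then the rate vanishes only in trivial situations: comparing
  the two estimates for one operator at a point outside \<open>S\<close> bounds \<open>\<nu>\<^sup>2\<close> by
  \<open>\<gamma>\<^sub>j / c\<^sub>j\<close>, a single term of the sum in the rate.\<close>

lemma rho_pos:
  assumes y: "y \<in> cball w (del / 2)" "y \<notin> S" and l2: "2 \<le> l"
  shows "0 < rho"
proof -
  define s where "s = (\<Sum>k<l. 1 / c k)"
  have dS: "0 < infdist y S"
    using y(2) S_closed w_S infdist_pos_not_in_closed by blast
  obtain j where j: "j < l" "Max ((\<lambda>k. infdist y (Z k)) ` {..<l}) = infdist y (Z j)"
    by (rule Max_attained)
  define e where "e = infdist y (Z j)"
  have le: "infdist y S \<le> kap * e" using regular[OF y(1)] j by (simp add: S_def e_def)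
  \<comment> \<open>As \<open>Z j\<close> is the farthest of the sets and contains \<open>S\<close>,
    regularity at a point outside \<open>S\<close> forces \<open>1 \<le> kap\<close>.\<close>
  have "S \<subseteq> Z j" using j by (auto simp: S_def)
  then have "e \<le> infdist y S" unfolding e_def using w_S by (intro infdist_mono) auto
  with le have "e \<le> kap * e" by simp
  moreover have e0: "0 < e"
    using dS le kap by (metis infdist_nonneg e_def mult_zero_right not_less less_eq_real_def order_le_less_trans)
  ultimately have "1 \<le> kap" by simp
  then have kap2: "1 \<le> kap\<^sup>2" by simp
  obtain y' where y': "y' \<in> T j y" using T_nonempty j by blast
  obtain z where z: "z \<in> Z j" "z \<in> cball w del" "norm (y - z) = e"
    using nearest_in_ball[OF Z_closed[OF j(1)] w_Z[OF j(1)] y(1)] e_def by metis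
  have "(nu * e)\<^sup>2 \<le> (norm (y - y'))\<^sup>2"
    using coercive[OF j(1) y(1) y'] nu e0 by (intro power_mono) (auto simp: e_def)
  then have "c j * (nu * e)\<^sup>2 \<le> c j * (norm (y - y'))\<^sup>2" using c[OF j(1)] by simp
  also have "\<dots> \<le> g j * e\<^sup>2"
    using order_trans[OF zero_le_power2 quasi[OF j(1) y(1) y' z(1,2)]] by (simp add: z(3))
  finally have "(c j * nu\<^sup>2) * e\<^sup>2 \<le> g j * e\<^sup>2" by (simp add: power_mult_distrib mult_ac)
  then have "c j * nu\<^sup>2 \<le> g j" using e0 by simp
  then have "nu\<^sup>2 \<le> g j * (1 / c j)" using c[OF j(1)] by (simp add: pos_le_divide_eq mult.commute)
  also have "\<dots> \<le> Gam\<^sup>2 * (1 / c j)"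
    using Gam_square_ge_factor[OF j(1)] c[OF j(1)] by (intro mult_right_mono) auto
  also have "\<dots> < Gam\<^sup>2 * s"
  proof -
    have "s = 1 / c j + (\<Sum>k\<in>{..<l} - {j}. 1 / c k)"
      unfolding s_def using j by (intro sum.remove) auto
    \<comment> \<open>Since \<open>l \<ge> 2\<close>, the sum has a term other than that of
      \<open>j\<close>, which makes the comparison strict.\<close>
    moreover have "(if j = 0 then 1 else 0) \<in> {..<l} - {j}" using l2 by auto
    then have "0 < (\<Sum>k\<in>{..<l} - {j}. 1 / c k)" using c by (intro sum_pos) auto
    ultimately have "1 / c j < s" by simp
    then show ?thesis using Gam_ge_1 by (intro mult_strict_left_mono) auto
  qed
  finally have nu_less: "nu\<^sup>2 < Gam\<^sup>2 * s" .
  have s0: "0 < s" unfolding s_def using l c by (intro sum_pos) auto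
  have "nu\<^sup>2 / kap\<^sup>2 \<le> nu\<^sup>2" using kap2 by (simp add: divide_le_eq mult_le_cancel_left1)
  then have "nu\<^sup>2 / kap\<^sup>2 < Gam\<^sup>2 * s" using nu_less by simp
  then have "nu\<^sup>2 / kap\<^sup>2 / s < Gam\<^sup>2" by (subst pos_divide_less_eq[OF s0])
  then have "nu\<^sup>2 / kap\<^sup>2 * inverse s < Gam\<^sup>2" by (simp only: divide_inverse)
  then show ?thesis unfolding rho s_def[symmetric] using l by (intro real_root_gt_zero) auto
qed

section \<open>The whole sequence: cycle starts, then all indices\<close>

context
  fixes x :: "nat \<Rightarrow> 'a"
  assumes seq: "\<And>n. x (Suc n) \<in> T (n mod l) (x n)"
begin

lemma cycle_steps: "k < l \<Longrightarrow> x (l * n + Suc k) \<in> T k (x (l * n + k))"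
  using seq[of "l * n + k"] by simp

lemma cycle_start:
  assumes "x (l * n) \<in> cball w del0"
  shows "infdist (x (l * Suc n)) S \<le> rho ^ l * infdist (x (l * n)) S"
    "norm (x (l * Suc n) - x (l * n)) \<le> (1 + rho ^ l) * infdist (x (l * n)) S"
  using cycle_contraction[of "\<lambda>k. x (l * n + k)"] assms cycle_steps
  by (simp_all add: add.commute)

lemma rate: "0 \<le> rho ^ l" "rho ^ l < 1" "rho ^ l \<le> rho"
proof -
  show "0 \<le> rho ^ l" using rho_nonneg by simp
  show "rho ^ l \<le> rho" using power_decreasing[of 1 l rho] rho_nonneg rho_less l by simp
  then show "rho ^ l < 1" using rho_less by simp
qed

lemma infdist_geometric:
  assumes "\<And>k. k < n \<Longrightarrow> x (l * k) \<in> cball w del0"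
  shows "infdist (x (l * n)) S \<le> (rho ^ l) ^ n * infdist (x 0) S"
  using assms
proof (induction n)
  case (Suc n)
  have "infdist (x (l * Suc n)) S \<le> rho ^ l * infdist (x (l * n)) S" using Suc by (intro cycle_start) auto
  also have "\<dots> \<le> rho ^ l * ((rho ^ l) ^ n * infdist (x 0) S)"
    using Suc rate by (intro mult_left_mono) auto
  finally show ?case by (simp add: mult.assoc)
qed simp

lemma step_geometric:
  assumes "\<And>k. k \<le> n \<Longrightarrow> x (l * k) \<in> cball w del0"
  shows "norm (x (l * Suc n) - x (l * n)) \<le> (1 + rho ^ l) * infdist (x 0) S * (rho ^ l) ^ n"
proof -
  have "norm (x (l * Suc n) - x (l * n)) \<le> (1 + rho ^ l) * infdist (x (l * n)) S"
    using assms by (intro cycle_start) auto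
  also have "\<dots> \<le> (1 + rho ^ l) * ((rho ^ l) ^ n * infdist (x 0) S)"
    using infdist_geometric[of n] assms rate by (intro mult_left_mono) auto
  finally show ?thesis by (simp add: mult_ac)
qed

text \<open>Contraction at a cycle start presupposes that this start and all earlier ones lie in the
  ball. The distance bound and the membership are therefore proved in one induction.\<close>

lemma stays_in_ball:
  assumes start: "x 0 \<in> cball w (del0 * (1 - rho) / (2 + Gam - rho))"
  shows "x (l * n) \<in> cball w del0"
proof -
  define q r where "q = rho ^ l" and "r = norm (x 0 - w)"
  have q: "0 \<le> q" "q < 1" "q \<le> rho" using rate by (auto simp: q_def)
  have "r \<le> del0 * (1 - rho) / (2 + Gam - rho)" using start by (simp add: r_def dist_norm norm_minus_commute)
  \<comment> \<open>Here \<open>2 + Gam - rho\<close> is at least 2, because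
    \<open>Gam \<ge> 1\<close> and \<open>rho < 1\<close>.\<close>
  also have "\<dots> \<le> del0 * (1 - rho) / 2"
    using del0_nonneg rho_less Gam_ge_1 by (intro divide_left_mono) auto
  also have "\<dots> \<le> del0 * (1 - q) / 2" using q del0_nonneg by (simp add: mult_left_mono)
  finally have r: "2 * r \<le> del0 * (1 - q)" by simp
  have d0: "infdist (x 0) S \<le> r" using infdist_le[OF w_S, of "x 0"] by (simp add: r_def dist_norm)
  have r0: "0 \<le> r" by (simp add: r_def)
  \<comment> \<open>The initial distance contributes \<open>(1 - q) * r\<close> and the geometric
    series at most \<open>(1 + q) * r\<close>.\<close>
  have bound: "(1 - q) * (r + (\<Sum>k<n. (1 + q) * r * q ^ k)) \<le> 2 * r" for n
  proof -
    have "(1 - q) * (\<Sum>k<n. (1 + q) * r * q ^ k) = (1 + q) * r * (1 - q ^ n)"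
      using q by (simp add: sum_distrib_left[symmetric] sum_gp_strict)
    also have "\<dots> \<le> (1 + q) * r" using q r0 by (simp add: mult_left_le)
    finally show ?thesis by (simp add: algebra_simps)
  qed
  have "norm (x (l * n) - w) \<le> r + (\<Sum>k<n. (1 + q) * r * q ^ k) \<and> x (l * n) \<in> cball w del0"
  proof (induction n rule: less_induct)
    case (less n)
    have 1: "norm (x (l * n) - w) \<le> r + (\<Sum>k<n. (1 + q) * r * q ^ k)"
    proof (cases n)
      case (Suc m)
      have ball: "x (l * k) \<in> cball w del0" if "k \<le> m" for k using less[of k] that Suc by simp
      have "norm (x (l * Suc m) - x (l * m)) \<le> (1 + q) * infdist (x 0) S * q ^ m"
        unfolding q_def by (rule step_geometric) (rule ball)
      also have "\<dots> \<le> (1 + q) * r * q ^ m" using q d0 by (intro mult_right_mono mult_left_mono) auto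
      finally have "norm (x (l * Suc m) - x (l * m)) \<le> (1 + q) * r * q ^ m" .
      moreover have "norm (x (l * m) - w) \<le> r + (\<Sum>k<m. (1 + q) * r * q ^ k)" using less[of m] Suc by simp
      moreover have "norm (x (l * Suc m) - w) \<le> norm (x (l * Suc m) - x (l * m)) + norm (x (l * m) - w)"
        using norm_triangle_ineq[of "x (l * Suc m) - x (l * m)" "x (l * m) - w"] by simp
      ultimately show ?thesis unfolding Suc sum.lessThan_Suc by linarith
    qed (simp add: r_def)
    have "(1 - q) * norm (x (l * n) - w) \<le> (1 - q) * (r + (\<Sum>k<n. (1 + q) * r * q ^ k))"
      using 1 q by (intro mult_left_mono) auto
    also have "\<dots> \<le> (1 - q) * del0" using bound[of n] r by (simp add: mult.commute)
    finally have "norm (x (l * n) - w) \<le> del0" using q by simp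
    with 1 show ?case by (simp add: dist_norm norm_minus_commute)
  qed
  then show ?thesis by simp
qed

lemma convergence_in_ball:
  assumes ball: "\<And>n. x (l * n) \<in> cball w del0"
  shows "\<exists>xb \<in> S. \<exists>\<sigma>\<ge>0. \<forall>n. norm (x n - xb) \<le> \<sigma> * rho ^ n"
proof (cases "x 0 \<in> S")
  \<comment> \<open>\<open>rho_pos\<close> needs a point outside \<open>S\<close>, so this case must
    allow \<open>rho = 0\<close>. The quasi-Fejer inequality with \<open>z = x 0\<close> shows that
    the sequence is constant, and \<open>\<sigma> = 0\<close> works.\<close>
  case True
  have x0: "x 0 \<in> cball w (del / 2)" "x 0 \<in> cball w del" using ball[of 0] del0_le del by auto
  have "x n = x 0" for n
  proof (induction n)
    case (Suc n)
    have n: "n mod l < l" using l by simp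
    have "x 0 \<in> Z (n mod l)" using True n by (auto simp: S_def)
    then have "(norm (x (Suc n) - x 0))\<^sup>2 \<le> - (c (n mod l) * (norm (x 0 - x (Suc n)))\<^sup>2)"
      using quasi[OF n x0(1) seq[of n, unfolded Suc] _ x0(2)] by simp
    also have "\<dots> \<le> 0" using c[OF n] by simp
    finally show ?case by simp
  qed simp
  then show ?thesis using True by (intro bexI[of _ "x 0"] exI[of _ 0]) auto
next
  case False
  define q where "q = rho ^ l"
  define d where "d = infdist (x 0) S"
  have q: "0 \<le> q" "q < 1" using rate by (auto simp: q_def)
  have d0: "0 \<le> d" by (simp add: d_def infdist_nonneg)
  have "norm (x (l * Suc n) - x (l * n)) \<le> (1 + q) * d * q ^ n" for n
    unfolding q_def d_def by (rule step_geometric) (rule ball)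
  from geometric_steps_limit[where f = "\<lambda>n. x (l * n)", OF q this]
  obtain xb where lim: "(\<lambda>n. x (l * n)) \<longlonglongrightarrow> xb"
    and xb: "\<And>n. norm (x (l * n) - xb) \<le> (1 + q) * d / (1 - q) * q ^ n" by blast
  define M where "M = (1 + q) * d / (1 - q)"
  have M0: "0 \<le> M" using q d0 by (simp add: M_def)
  have xb_ball: "xb \<in> cball w del0"
    by (rule Lim_in_closed_set[OF closed_cball _ _ lim]) (use ball in auto)
  then have xb_ball': "xb \<in> cball w del" using del0_le del by auto
  have "(\<lambda>n. infdist (x (l * n)) S) \<longlonglongrightarrow> infdist xb S" by (intro tendsto_infdist lim)
  moreover have "(\<lambda>n. infdist (x (l * n)) S) \<longlonglongrightarrow> 0"
  proof (rule tendsto_sandwich[OF _ _ tendsto_const])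
    show "(\<lambda>n. q ^ n * d) \<longlonglongrightarrow> 0" using tendsto_mult_left_zero[OF LIMSEQ_realpow_zero[OF q]] by simp
    show "\<forall>\<^sub>F n in sequentially. infdist (x (l * n)) S \<le> q ^ n * d"
      unfolding q_def d_def using infdist_geometric ball by simp
  qed (simp add: infdist_nonneg)
  ultimately have "infdist xb S = 0" by (rule LIMSEQ_unique)
  then have xbS: "xb \<in> S" using in_closed_iff_infdist_zero[OF S_closed] w_S by blast
  \<comment> \<open>Inside a cycle there is no contraction; \<open>x n\<close> is compared with the
    start of its cycle at the cost of \<open>Gam\<close>.\<close>
  have bound: "norm (x n - xb) \<le> Gam * M * rho ^ (l * (n div l))" for n
  proof -
    have "norm (x (l * (n div l) + n mod l) - xb) \<le> Gam * norm (x (l * (n div l) + 0) - xb)"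
      using ball l by (intro cycle_bound[where y = "\<lambda>k. x (l * (n div l) + k)"] xbS xb_ball' cycle_steps)
        (auto simp: less_imp_le)
    also have "\<dots> \<le> Gam * (M * q ^ (n div l))"
      using xb[of "n div l"] Gam_ge_1 by (intro mult_left_mono) (auto simp: M_def)
    finally show ?thesis by (simp add: q_def power_mult mult.assoc)
  qed
  show ?thesis
  \<comment> \<open>For \<open>l = 1\<close> every index starts a cycle, and \<open>bound\<close>
    suffices even if \<open>rho = 0\<close>. Otherwise the delay \<open>n mod l\<close> costs at
    most a factor \<open>1 / rho ^ l\<close>, for which \<open>rho\<close> must be positive.\<close>
  proof (cases "l = 1")
    case True
    then show ?thesis using bound xbS M0 Gam_ge_1 by (intro bexI[of _ xb] exI[of _ "Gam * M"]) auto
  next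
    case l1: False
    have "x 0 \<in> cball w (del / 2)" using ball[of 0] del0_le by auto
    then have rho0: "0 < rho" using rho_pos[of "x 0"] False l l1 by simp
    have "norm (x n - xb) \<le> Gam * M / rho ^ l * rho ^ n" for n
    proof -
      have "rho ^ l \<le> rho ^ (n mod l)" using rho0 rho_less l by (intro power_decreasing) (auto simp: less_imp_le)
      then have "rho ^ (l * (n div l)) * rho ^ l \<le> rho ^ (l * (n div l)) * rho ^ (n mod l)"
        using rho0 by (intro mult_left_mono) auto
      also have "\<dots> = rho ^ n" by (simp flip: power_add)
      finally have "rho ^ (l * (n div l)) \<le> rho ^ n / rho ^ l" using rho0 by (simp add: pos_le_divide_eq)
      then have "Gam * M * rho ^ (l * (n div l)) \<le> Gam * M * (rho ^ n / rho ^ l)"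
        using M0 Gam_ge_1 by (intro mult_left_mono) auto
      with bound[of n] show ?thesis by simp
    qed
    then show ?thesis using xbS M0 Gam_ge_1 rho0
      by (intro bexI[of _ xb] exI[of _ "Gam * M / rho ^ l"]) auto
  qed
qed

theorem linear_convergence:
  assumes "(\<forall>n. x (l * n) \<in> cball w del0) \<or> x 0 \<in> cball w (del0 * (1 - rho) / (2 + Gam - rho))"
  shows "\<exists>xb \<in> S. R_linearly_convergent x xb rho"
  using convergence_in_ball stays_in_ball assms rho_nonneg rho_less
  unfolding R_linearly_convergent_def by meson

end

end

subsection \<open>Linear convergence of the cyclic algorithm\<close>

theorem theorem5p4:
  fixes m l :: nat
    and I J :: "nat set"
    and C :: "nat \<Rightarrow> 'a::euclidean_space set"
    and lam \<mu> \<beta> \<alpha> \<kappa>' \<theta> \<gamma> \<nu> \<nu>' :: "nat \<Rightarrow> real"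
    and s t :: "nat \<Rightarrow> nat"
    and T :: "nat \<Rightarrow> 'a \<Rightarrow> 'a set"
    and L Z :: "nat \<Rightarrow> 'a set"
    and w :: 'a
    and \<epsilon> \<delta> \<kappa> \<Gamma> \<nu>\<^sub>m\<^sub>i\<^sub>n \<rho> \<delta>\<^sub>0 :: real
    and x :: "nat \<Rightarrow> 'a"
  assumes "m > 0" and "l > 0" and I: "I = {1..m}" and J: "J = {1..l}"
    and closed: "\<forall>i\<in>I. closed (C i)"
    and nonempty: "(\<Inter>i\<in>I. C i) \<noteq> {}"
    and lambda: "\<forall>j\<in>J. 0 < lam j \<and> lam j \<le> 2"
    and mu: "\<forall>j\<in>J. 0 < \<mu> j \<and> \<mu> j \<le> 2"
    and beta: "\<forall>j\<in>J. \<beta> j = (if lam j = 2 \<or> \<mu> j = 2 then 0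
                 else inverse (lam j / (2 - lam j) + \<mu> j / (2 - \<mu> j)))"
    and alpha: "\<forall>j\<in>J. 0 < \<alpha> j \<and> \<alpha> j < 1 + \<beta> j"
    and s_t: "\<forall>j\<in>J. s j \<in> I \<and> t j \<in> I \<and> s j \<noteq> t j"
    and cover: "s ` J \<union> t ` J = I"
    and T: "\<forall>j\<in>J. T j = DR_operator (\<alpha> j) (lam j) (\<mu> j) (C (s j)) (C (t j))"
    and L: "\<forall>j\<in>J. L j = affine hull (C (s j) \<union> C (t j))"
    and Z: "\<forall>j\<in>J. Z j = (if lam j = 2 \<and> \<mu> j = 2
                 then (C (s j) \<inter> C (t j)) + orthogonal_comp (direction_space (L j))
                 else C (s j) \<inter> C (t j))"
    and w: "w \<in> (\<Inter>i\<in>I. C i)"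
    and eps: "0 \<le> \<epsilon>" "\<epsilon> \<le> 1/3"
    and delta: "\<delta> > 0"
    and kappa: "\<kappa> > 0" "\<forall>j\<in>J. \<kappa>' j > 0"
    and a1: "linearly_regular \<kappa> J Z (cball w (\<delta> / 2))"
    and a2: "\<forall>j\<in>J. linearly_regular (\<kappa>' j) {s j, t j} C (cball w (\<delta> / 2))"
    and b: "\<forall>i\<in>I. eps_delta_regular \<epsilon> (sqrt 2 * \<delta>) (C i) w"
    and theta: "\<forall>j\<in>J. \<theta> j = CQ_number (C (s j)) (C (t j)) (L j) w (sqrt 2 * \<delta>)"
    and c: "\<forall>j\<in>J. \<theta> j < 1"
    and gamma: "\<forall>j\<in>J. \<gamma> j = 1 - \<alpha> j
                 + \<alpha> j * (1 + lam j * \<epsilon> / (1 - \<epsilon>)) * (1 + \<mu> j * \<epsilon> / (1 - \<epsilon>))"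
    and nu: "\<forall>j\<in>J. \<nu> j = \<alpha> j * sqrt (1 - (\<theta> j)\<^sup>2) / \<kappa>' j
                 * min (lam j) (2 * \<mu> j /
                     (\<bar>1 - \<mu> j\<bar> + sqrt ((1 - \<mu> j)\<^sup>2 + 4 * \<mu> j * (1 - (\<theta> j)\<^sup>2))))"
    and nu': "\<forall>j\<in>J. \<nu>' j = (if (lam j = 2 \<and> \<mu> j = 2) \<or> L j = UNIV then \<nu> j
                 else min (\<nu> j) (\<alpha> j * (lam j + \<mu> j - lam j * \<mu> j)))"
    and Gamma: "\<Gamma> = sqrt (\<Prod>j\<in>J. \<gamma> j)"
    and nu_min: "\<nu>\<^sub>m\<^sub>i\<^sub>n = Min ((\<lambda>j. min (\<nu>' j) 1) ` J)"
    and rho: "\<rho> = root (2 * l) (max 0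
                 (\<Gamma>\<^sup>2 - \<nu>\<^sub>m\<^sub>i\<^sub>n\<^sup>2 / \<kappa>\<^sup>2 * inverse (\<Sum>j\<in>J. \<alpha> j / (1 - \<alpha> j + \<beta> j))))"
    and d: "\<rho> < 1"
    and seq: "cyclic_sequence l T x"
    and delta0: "\<delta>\<^sub>0 = \<delta> / (2 * \<Gamma>) * sqrt (\<gamma> l)"
    and start: "(\<forall>n. x (l * n) \<in> cball w \<delta>\<^sub>0) \<or>
                x 0 \<in> cball w (\<delta>\<^sub>0 * (1 - \<rho>) / (2 + \<Gamma> - \<rho>))"
  shows "(\<Inter>j\<in>J. Z j) \<subseteq> (\<Inter>j\<in>J. Fix (T j)) \<and>
    (\<exists>xbar \<in> (\<Inter>j\<in>J. Z j).
       R_linearly_convergent x xbar \<rho> \<and>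
       (algorithm_connected I J s t \<longrightarrow>
          (\<exists>p \<in> (\<Inter>i\<in>I. C i). \<forall>i\<in>I. projector (C i) xbar = {p})))"
proof -
  have J_fin: "finite J" "J \<noteq> {}" and J_Suc: "J = Suc ` {..<l}" using J \<open>l > 0\<close>
    by (auto simp: image_Suc_lessThan)
  have wC: "w \<in> C i" if "i \<in> I" for i using w that by blast
  have pair: "DR_pair (C (s j)) (C (t j)) (L j) (Z j) w \<epsilon> \<delta> (lam j) (\<mu> j) (\<beta> j) (\<alpha> j) (\<kappa>' j)
      (\<theta> j) (\<gamma> j) (\<nu> j) (\<nu>' j)" if j: "j \<in> J" for j
  proof
    have st: "s j \<in> I" "t j \<in> I" using s_t j by auto
    show "closed (C (s j))" "closed (C (t j))" "w \<in> C (s j)" "w \<in> C (t j)"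
      using closed wC st by auto
    show "eps_delta_regular \<epsilon> (sqrt 2 * \<delta>) (C (s j)) w" "eps_delta_regular \<epsilon> (sqrt 2 * \<delta>) (C (t j)) w"
      using b st by auto
    show "infdist x (C (s j) \<inter> C (t j)) \<le> \<kappa>' j * max (infdist x (C (s j))) (infdist x (C (t j)))"
      if "x \<in> cball w (\<delta> / 2)" for x
      using a2 j that by (simp add: linearly_regular_def)
  qed (use j eps delta lambda mu beta alpha L Z kappa theta c gamma nu nu' in \<open>blast+\<close>)
  define S where "S = (\<Inter>j\<in>J. Z j)"
  have S_eq: "S = (\<Inter>k<l. Z (Suc k))" unfolding S_def J_Suc by simp
  have \<nu>_le: "\<nu>\<^sub>m\<^sub>i\<^sub>n \<le> min (\<nu>' j) 1" if "j \<in> J" for j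
    unfolding nu_min using that J_fin by (intro Min_le) auto
  have \<nu>_ge: "0 \<le> \<nu>\<^sub>m\<^sub>i\<^sub>n"
    unfolding nu_min using J_fin DR_pair.nu'_nonneg[OF pair] by (subst Min_ge_iff) auto
  have Suc_J: "Suc k \<in> J" if "k < l" for k using that by (simp add: J_Suc)
  have cyc: "cyclic_quasi_Fejer (\<lambda>k. T (Suc k)) (\<lambda>k. Z (Suc k)) w \<delta> \<kappa> \<nu>\<^sub>m\<^sub>i\<^sub>n \<Gamma> \<rho> l
      (\<lambda>k. \<gamma> (Suc k)) (\<lambda>k. (1 - \<alpha> (Suc k) + \<beta> (Suc k)) / \<alpha> (Suc k))"
  proof
    show "0 < l" "0 < \<delta>" "0 < \<kappa>" "0 \<le> \<nu>\<^sub>m\<^sub>i\<^sub>n" "\<rho> < 1" by fact+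
    show "\<nu>\<^sub>m\<^sub>i\<^sub>n \<le> 1" using \<nu>_le J_fin by fastforce
    show "infdist x (\<Inter>k<l. Z (Suc k)) \<le> \<kappa> * Max ((\<lambda>k. infdist x (Z (Suc k))) ` {..<l})"
      if "x \<in> cball w (\<delta> / 2)" for x
      using a1 that by (simp add: linearly_regular_def J_Suc image_image)
    have J1: "J = {Suc 0..l}" using J by simp
    show "\<Gamma> = sqrt (\<Prod>k<l. \<gamma> (Suc k))" unfolding Gamma J1 prod.atLeast1_atMost_eq ..
    show "\<rho> = root (2 * l) (max 0 (\<Gamma>\<^sup>2 - \<nu>\<^sub>m\<^sub>i\<^sub>n\<^sup>2 / \<kappa>\<^sup>2
        * inverse (\<Sum>k<l. 1 / ((1 - \<alpha> (Suc k) + \<beta> (Suc k)) / \<alpha> (Suc k)))))"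
      unfolding rho J1 sum.atLeast1_atMost_eq by simp
    fix k assume k: "k < l"
    interpret DR_pair "C (s (Suc k))" "C (t (Suc k))" "L (Suc k)" "Z (Suc k)" w \<epsilon> \<delta> "lam (Suc k)"
      "\<mu> (Suc k)" "\<beta> (Suc k)" "\<alpha> (Suc k)" "\<kappa>' (Suc k)" "\<theta> (Suc k)" "\<gamma> (Suc k)" "\<nu> (Suc k)" "\<nu>' (Suc k)"
      by (rule pair[OF Suc_J[OF k]])
    have Tk: "T (Suc k) = DR_operator (\<alpha> (Suc k)) (lam (Suc k)) (\<mu> (Suc k)) (C (s (Suc k))) (C (t (Suc k)))"
      using T Suc_J[OF k] by blast
    show "closed (Z (Suc k))" by (rule Z_closed)
    show "w \<in> Z (Suc k)" by (rule w_Z)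
    show "T (Suc k) x \<noteq> {}" for x unfolding Tk by (rule DR_nonempty)
    show "1 \<le> \<gamma> (Suc k)" by (rule gam_ge_1)
    show "0 < (1 - \<alpha> (Suc k) + \<beta> (Suc k)) / \<alpha> (Suc k)" using al by simp
    fix x x' assume x: "x \<in> cball w (\<delta> / 2)" and x': "x' \<in> T (Suc k) x"
    show "(norm (x' - z))\<^sup>2 \<le> \<gamma> (Suc k) * (norm (x - z))\<^sup>2
        - (1 - \<alpha> (Suc k) + \<beta> (Suc k)) / \<alpha> (Suc k) * (norm (x - x'))\<^sup>2"
      if "z \<in> Z (Suc k)" "z \<in> cball w \<delta>" for z
      by (rule quasi_Fejer[OF x x'[unfolded Tk] that])
    have "\<nu>\<^sub>m\<^sub>i\<^sub>n * infdist x (Z (Suc k)) \<le> \<nu>' (Suc k) * infdist x (Z (Suc k))"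
      using \<nu>_le[OF Suc_J[OF k]] by (intro mult_right_mono) (auto simp: infdist_nonneg)
    also have "\<dots> \<le> norm (x - x')" by (rule coercive[OF x x'[unfolded Tk]])
    finally show "\<nu>\<^sub>m\<^sub>i\<^sub>n * infdist x (Z (Suc k)) \<le> norm (x - x')" .
  qed
  have seq': "x (Suc n) \<in> T (Suc (n mod l)) (x n)" for n
    using seq by (simp add: cyclic_sequence_def)
  \<comment> \<open>The shift of indices turns \<open>g (l - 1)\<close> into
    \<open>\<gamma> l\<close>.\<close>
  have "cyclic_quasi_Fejer.del0 \<delta> \<Gamma> l (\<lambda>k. \<gamma> (Suc k)) = \<delta>\<^sub>0"
    using \<open>l > 0\<close> by (simp add: cyclic_quasi_Fejer.del0_def[OF cyc] delta0)
  with cyclic_quasi_Fejer.linear_convergence[OF cyc, of x, OF seq'] start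
  obtain xb where xb: "xb \<in> S" "R_linearly_convergent x xb \<rho>"
    unfolding cyclic_quasi_Fejer.S_def[OF cyc] S_eq by auto
  have edge: "\<exists>p \<in> C (s j) \<inter> C (t j). projector (C (s j)) xb = {p} \<and> projector (C (t j)) xb = {p}"
    if "j \<in> J" for j
    by (rule DR_pair.Z_projector_eq[OF pair[OF that]]) (use xb(1) that S_def in blast)
  have "\<exists>p \<in> (\<Inter>i\<in>I. C i). \<forall>i\<in>I. projector (C i) xb = {p}" if conn: "algorithm_connected I J s t"
  proof -
    \<comment> \<open>By \<open>edge\<close> the two ends of an edge have the same singleton
      projection, so it is constant along walks; the common point then belongs to every
      \<open>C k\<close>. \<open>cover\<close> ensures that every vertex lies on an edge.\<close>
    define E where "E = {(s j, t j) | j. j \<in> J} \<union> {(t j, s j) | j. j \<in> J}"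
    have E_eq: "projector (C i) xb = projector (C k) xb" if "(i, k) \<in> E\<^sup>*" for i k
      using that
    proof (induction rule: rtrancl_induct)
      case (step a b)
      have "projector (C a) xb = projector (C b) xb" using step(2) edge unfolding E_def by force
      with step show ?case by simp
    qed simp
    have vertex: "\<exists>p \<in> C i. projector (C i) xb = {p}" if "i \<in> I" for i
      using that edge unfolding cover[symmetric] by blast
    obtain i where i: "i \<in> I" using I \<open>m > 0\<close> by force
    obtain p where p: "projector (C i) xb = {p}" using vertex[OF i] by blast
    have all: "projector (C k) xb = {p}" if "k \<in> I" for k
      using conn i that E_eq[of i k] p unfolding algorithm_connected_def E_def by simp
    then have "p \<in> C k" if "k \<in> I" for k using vertex[OF that] that by auto
    with all show ?thesis by blast
  qed
  moreover have "(\<Inter>j\<in>J. Z j) \<subseteq> (\<Inter>j\<in>J. Fix (T j))"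
    using DR_pair.Z_Fix[OF pair] T by fastforce
  ultimately show ?thesis using xb unfolding S_def by blast
qed

end
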